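(* Let $p\in(0,1)$. The intensity measure $I\boldsymbol{\mu}^{\mathrm{rec}}_p$ of the recursive separable permuton is the distribution of $$\big(U,\;U X_p+(1-U)X'_p\big),$$ where $U$, $X_p$ and $X'_p$ are independent random variables in $[0,1]$, with distributions $\mathrm{Leb}$, $\beta(p,1-p)$ and $\beta(1-p,p)$ respectively.
   Context: $\mathrm{Leb}$ is Lebesgue measure on $[0,1]$. A permuton is a Borel probability measure on $[0,1]^2$ with both marginals equal to $\mathrm{Leb}$. Recursive separable permuton $\boldsymbol{\mu}^{\mathrm{rec}}_p$: let $(U_j)_{j\ge1}$ be i.i.d. uniform in $[0,1]$ and $(S_j)_{j\ge1}$ be i.i.d. signs in $\{\oplus,\ominus\}$ with $\mathbb P(S_j=\oplus)=p$, the two sequences being independent. For $x<y$ in $[0,1]$ let $j$ be the minimal index $j\ge 1$ such that $U_j\in(x,y]$; set $x\prec y$ if $S_j=\oplus$ and $y\prec x$ if $S_j=\ominus$ (no comparison if there is no such $j$). Let $\phi(x)=\mathrm{Leb}(\{y\in[0,1]: y\prec x\})$ and let $\boldsymbol{\mu}^{\mathrm{rec}}_p$ be the push-forward of $\mathrm{Leb}$ by $x\mapsto(x,\phi(x))$; this is almost surely a permuton. The intensity measure of a random measure $\boldsymbol{\mu}$ is $I\boldsymbol{\mu}(A)=\mathbb E[\boldsymbol{\mu}(A)]$ for all measurable $A$. For $a,b>0$, $\beta(a,b)$ is the distribution $\frac{\Gamma(a+b)}{\Gamma(a)\Gamma(b)}x^{a-1}(1-x)^{b-1}\,dx$ on $[0,1]$.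 *)

theory Defs
  imports "HOL-Probability.Probability"
begin

text \<open>Measures on \<open>[0,1]\<close> and \<open>[0,1]\<^sup>2\<close> are represented as Borel measures on
  \<open>\<real>\<close> and \<open>\<real>\<^sup>2\<close> that are carried by the unit interval and the unit square.\<close>

definition leb_unit :: "real measure" where
  "leb_unit = uniform_measure lborel {0..1}"

definition beta_distribution :: "real \<Rightarrow> real \<Rightarrow> real measure" where
  "beta_distribution a b = density lborel (\<lambda>x. ennreal (indicator {0..1} x *
     (Gamma (a + b) / (Gamma a * Gamma b) * x powr (a - 1) * (1 - x) powr (b - 1))))"

text \<open>In the next three definitions \<open>u\<close> and \<open>s\<close> are realisations of the sequence of uniform
  points and of the sequence of signs, with \<open>True\<close> for \<open>\<oplus>\<close> and \<open>False\<close> for \<open>\<ominus>\<close>.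
  Sequences are indexed from 0 instead of 1.
  The first disjunct of \<open>rec_prec u s x y\<close> is the case \<open>x < y\<close> with sign \<open>\<oplus>\<close>,
  the second is the case \<open>y < x\<close> with sign \<open>\<ominus>\<close>.\<close>

definition rec_prec :: "(nat \<Rightarrow> real) \<Rightarrow> (nat \<Rightarrow> bool) \<Rightarrow> real \<Rightarrow> real \<Rightarrow> bool" where
  "rec_prec u s x y \<longleftrightarrow>
     (x < y \<and> (\<exists>j. u j \<in> {x<..y}) \<and> s (LEAST j. u j \<in> {x<..y})) \<or>
     (y < x \<and> (\<exists>j. u j \<in> {y<..x}) \<and> \<not> s (LEAST j. u j \<in> {y<..x}))"

definition rec_phi :: "(nat \<Rightarrow> real) \<Rightarrow> (nat \<Rightarrow> bool) \<Rightarrow> real \<Rightarrow> real" where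
  "rec_phi u s x = measure leb_unit {y \<in> {0..1}. rec_prec u s y x}"

definition rec_separable_permuton ::
    "(nat \<Rightarrow> real) \<Rightarrow> (nat \<Rightarrow> bool) \<Rightarrow> (real \<times> real) measure" where
  "rec_separable_permuton u s = distr leb_unit borel (\<lambda>x. (x, rec_phi u s x))"

text \<open>The intensity measure, on the measurable space of \<open>N\<close>, of a random measure
  \<open>\<mu>\<close> defined on the probability space \<open>M\<close>.\<close>

definition intensity_measure :: "'a measure \<Rightarrow> 'b measure \<Rightarrow> ('a \<Rightarrow> 'b measure) \<Rightarrow> 'b measure" where
  "intensity_measure M N \<mu> =
     measure_of (space N) (sets N) (\<lambda>A. \<integral>\<^sup>+ \<omega>. emeasure (\<mu> \<omega>) A \<partial>M)"

end

theory Submission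
  imports Defs
begin

text \<open>Fix \<open>x\<close> in \<open>[0,1]\<close>.
  The claim is that the random number \<open>\<phi>(x)\<close> has the law of \<open>x X + (1 - x) X'\<close>;
  integrating over \<open>x\<close> with Fubini's theorem then gives the intensity measure.

  For an interval \<open>[a,b)\<close> around \<open>x\<close> consider the mass of the points \<open>y\<close> in \<open>[a,b)\<close> with
  \<open>y \<prec> x\<close>, and reveal the first point \<open>v\<close> of the sequence with its sign.
  If \<open>v\<close> lies in \<open>(a,x]\<close>, it separates every \<open>y\<close> in \<open>[a,v)\<close> from \<open>x\<close>, so the sign decides
  about the whole block \<open>[a,v)\<close>, while the points of \<open>[v,b)\<close> are compared with \<open>x\<close> by the
  remaining sequence, which has the same law as the full one.
  The case of \<open>v\<close> in \<open>(x,b]\<close> is the mirror image, and all other \<open>v\<close> have no effect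
  (\<open>prec_mass_case_nat\<close>).
  Hence the characteristic function of the mass, as a function of \<open>a\<close> and \<open>b\<close>, solves a linear
  integral equation (\<open>prec_mass_char_fixed_point\<close>).

  The equation has at most one solution that is close to \<open>1\<close> on short intervals: if the
  difference of two solutions is bounded by \<open>C (b - a)\<close>, it is also bounded by
  \<open>3/4 C (b - a)\<close>, because the expected length of the interval that is left after a point has
  fallen into it is at most three quarters of the old length
  (\<open>split_step_contraction\<close>, \<open>split_step_fixed_point_unique\<close>).

  The characteristic function of \<open>(x - a) X + (b - x) X'\<close> is such a solution
  (\<open>beta_mix_char_fixed_point\<close>).
  This rests on the stick-breaking property of \<open>\<beta>(p,1-p)\<close>: if \<open>X\<close> has this law, \<open>W\<close> is uniform
  and \<open>\<epsilon>\<close> is an indicator with success probability \<open>p\<close>, all independent, then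
  \<open>(1 - W) \<epsilon> + W X\<close> again has the law of \<open>X\<close> (\<open>char_beta_renewal\<close>).
  In terms of densities the property says that a certain function has integral zero, and an
  explicit antiderivative that vanishes at both endpoints proves it (\<open>beta_stein_identity\<close>).\<close>

section \<open>Integration against the uniform distribution\<close>

lemma prob_space_leb_unit: "prob_space leb_unit"
  unfolding leb_unit_def by (intro prob_space_uniform_measure) auto

lemma sets_leb_unit [measurable_cong, simp]: "sets leb_unit = sets borel"
  by (simp add: leb_unit_def)

lemma space_leb_unit [simp]: "space leb_unit = UNIV"
  by (simp add: leb_unit_def)

lemma AE_leb_unit: "AE x in leb_unit. 0 \<le> x \<and> x \<le> 1"
  unfolding leb_unit_def by (rule AE_uniform_measureI) auto

lemma leb_unit_eq_density: "leb_unit = density lborel (\<lambda>x. ennreal (indicator {0..1} x))"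
  by (simp add: leb_unit_def uniform_measure_def ennreal_indicator divide_ennreal_def)

lemma integral_leb_unit_Ioc:
  fixes f :: "real \<Rightarrow> 'a :: {banach, second_countable_topology}"
  assumes "0 \<le> a" "b \<le> 1" and [measurable]: "f \<in> borel_measurable borel"
  shows "(\<integral>v. indicator {a<..b} v *\<^sub>R f v \<partial>leb_unit) = (\<integral>v. indicator {a<..b} v *\<^sub>R f v \<partial>lborel)"
  unfolding leb_unit_eq_density using assms
  by (subst integral_density) (auto intro!: Bochner_Integration.integral_cong simp: indicator_def)

lemma integral_leb_unit_affine:
  assumes "0 \<le> a" "a \<le> b" "b \<le> 1"
  shows "(\<integral>v. indicator {a<..b} v * (c + d * v) \<partial>leb_unit) = (b - a) * (c + d * (a + b) / 2)"
proof -
  have "(\<integral>v. indicator {a<..b} v *\<^sub>R (c + d * v) \<partial>leb_unit) = (\<integral>v. indicator {a<..b} v *\<^sub>R (c + d * v) \<partial>lborel)"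
    using assms by (intro integral_leb_unit_Ioc) auto
  also have "\<dots> = (\<integral>v. indicator {a..b} v *\<^sub>R (c + d * v) \<partial>lborel)"
  proof (rule integral_cong_AE)
    show "AE v in lborel. indicator {a<..b} v *\<^sub>R (c + d * v) = indicator {a..b} v *\<^sub>R (c + d * v)"
      using AE_lborel_singleton[of a] by eventually_elim (auto simp: indicator_def)
  qed measurable
  also have "\<dots> = (c * b + d * b\<^sup>2 / 2) - (c * a + d * a\<^sup>2 / 2)"
    using assms
    by (intro integral_FTC_atLeastAtMost)
       (auto intro!: derivative_eq_intros continuous_intros
         simp: has_real_derivative_iff_has_vector_derivative[symmetric])
  also have "\<dots> = (b - a) * (c + d * (a + b) / 2)"
    by (simp add: field_simps power2_eq_square)
  finally show ?thesis by simp
qed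

section \<open>The beta distribution\<close>

lemma prob_space_beta_distribution:
  assumes "0 < a" "0 < b"
  shows "prob_space (beta_distribution a b)"
proof
  define w where "w t = t powr (a - 1) * (1 - t) powr (b - 1)" for t :: real
  have c: "0 < Beta a b" using assms by (simp add: Beta_def Gamma_real_pos)
  have "((\<lambda>t. w t / Beta a b) has_integral 1) {0..1}"
    using has_integral_divide[OF has_integral_Beta_real[OF assms], of "Beta a b"] c
    by (simp add: w_def)
  then have "((\<lambda>t. if t \<in> {0..1} then w t / Beta a b else 0) has_integral 1) UNIV"
    by (subst has_integral_restrict_UNIV)
  also have "(\<lambda>t. if t \<in> {0..1} then w t / Beta a b else 0)
      = (\<lambda>x. indicator {0..1} x * (Gamma (a + b) / (Gamma a * Gamma b)
              * x powr (a - 1) * (1 - x) powr (b - 1)))"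
    by (auto simp: fun_eq_iff w_def Beta_def)
  finally have I: "(\<dots> has_integral 1) UNIV" .
  have "(\<integral>\<^sup>+x. ennreal (indicator {0..1} x * (Gamma (a + b) / (Gamma a * Gamma b)
              * x powr (a - 1) * (1 - x) powr (b - 1))) \<partial>lborel) = ennreal 1"
    using assms
    by (intro nn_integral_has_integral_lborel I) (auto simp: Gamma_real_pos less_imp_le)
  then show "emeasure (beta_distribution a b) (space (beta_distribution a b)) = 1"
    by (simp add: beta_distribution_def emeasure_density)
qed

lemma sets_beta_distribution [measurable_cong, simp]: "sets (beta_distribution a b) = sets borel"
  by (simp add: beta_distribution_def)

lemma space_beta_distribution [simp]: "space (beta_distribution a b) = UNIV"
  by (simp add: beta_distribution_def)

lemma AE_beta_distribution: "AE x in beta_distribution a b. 0 < x \<and> x < 1"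
proof -
  have "AE x in lborel. x \<noteq> (0::real) \<and> x \<noteq> 1"
    using AE_lborel_singleton[of "0::real"] AE_lborel_singleton[of "1::real"] by eventually_elim auto
  then have "AE x in lborel. 0 < ennreal (indicator {0..1} x *
     (Gamma (a + b) / (Gamma a * Gamma b) * x powr (a - 1) * (1 - x) powr (b - 1)))
       \<longrightarrow> 0 < x \<and> x < 1"
    by eventually_elim (auto simp: indicator_def)
  then show ?thesis
    unfolding beta_distribution_def by (subst AE_density) auto
qed

text \<open>Taking the difference quotients of \<open>G\<close> at \<open>X\<close> towards \<open>1\<close> and \<open>0\<close>, with weights \<open>p\<close> and
  \<open>1 - p\<close>, does not change the expectation of \<open>G'(X)\<close>.
  With \<open>w(x) = x\<^sup>p\<^sup>-\<^sup>1 (1 - x)\<^sup>-\<^sup>p\<close>, the density up to a constant, the product of \<open>w\<close> and the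
  difference of the two integrands is the derivative of \<open>w(x) (G(x) - (1 - x) G(0) - x G(1))\<close>.
  The second factor is the error of linear interpolation of \<open>G\<close>; it is at most of order
  \<open>x (1 - x)\<close>, which makes the product vanish at both endpoints.\<close>
lemma beta_stein_identity:
  fixes G g :: "real \<Rightarrow> complex"
  assumes p: "0 < p" "p < 1"
    and G: "\<And>x. (G has_vector_derivative g x) (at x)"
    and g: "continuous_on UNIV g"
  shows "(\<integral>x. g x \<partial>beta_distribution p (1 - p)) =
     (\<integral>x. p *\<^sub>R ((G 1 - G x) /\<^sub>R (1 - x)) + (1 - p) *\<^sub>R ((G x - G 0) /\<^sub>R x)
        \<partial>beta_distribution p (1 - p))"
    (is "(\<integral>x. _ \<partial>?B) = (\<integral>x. ?r x \<partial>_)")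
proof -
  interpret prob_space ?B using p by (intro prob_space_beta_distribution) auto
  have contG: "continuous_on A G" for A
    by (meson G continuous_at_imp_continuous_on has_vector_derivative_continuous)
  have [measurable]: "g \<in> borel_measurable borel" "G \<in> borel_measurable borel"
    using g contG by (auto intro: borel_measurable_continuous_onI)
  have "compact (g ` {0..1})"
    by (intro compact_continuous_image continuous_on_subset[OF g]) auto
  from compact_imp_bounded[OF this]
  obtain K where "\<forall>y\<in>g ` {0..1}. norm y \<le> K"
    unfolding bounded_iff ..
  then have K: "norm (g x) \<le> K" if "x \<in> {0..1}" for x
    using that by blast
  have lip: "norm (G y - G x) \<le> K * \<bar>y - x\<bar>" if "x \<in> {0..1}" "y \<in> {0..1}" for x y
    unfolding real_norm_def[symmetric]
  proof (rule differentiable_bound[of "{0..1}" G "\<lambda>x h. h *\<^sub>R g x"])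
    show "(G has_derivative (\<lambda>h. h *\<^sub>R g t)) (at t within {0..1})" for t
      using has_vector_derivative_at_within[OF G] by (simp add: has_vector_derivative_def)
    show "onorm (\<lambda>h. h *\<^sub>R g t) \<le> K" if "t \<in> {0..1}" for t
      using K[OF that] by (intro onorm_le) (simp add: mult.commute[of K] mult_left_mono)
  qed (use that in auto)
  have b1: "norm ((G 1 - G x) /\<^sub>R (1 - x)) \<le> K" if "0 < x" "x < 1" for x
    using lip[of x 1] that pos_divide_le_eq[of "1 - x" "norm (G 1 - G x)" K]
    by (simp only: norm_scaleR) (simp add: divide_inverse_commute)
  have b2: "norm ((G x - G 0) /\<^sub>R x) \<le> K" if "0 < x" "x < 1" for x
    using lip[of 0 x] that pos_divide_le_eq[of x "norm (G x - G 0)" K]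
    by (simp only: norm_scaleR) (simp add: divide_inverse_commute)
  have b3: "norm (?r x) \<le> K" if "0 < x" "x < 1" for x
  proof -
    have "norm (?r x) \<le> p * norm ((G 1 - G x) /\<^sub>R (1 - x)) + (1 - p) * norm ((G x - G 0) /\<^sub>R x)"
      using p norm_triangle_ineq[of "p *\<^sub>R ((G 1 - G x) /\<^sub>R (1 - x))" "(1 - p) *\<^sub>R ((G x - G 0) /\<^sub>R x)"]
      by (simp only: norm_scaleR[of p] norm_scaleR[of "1 - p"])
    also have "\<dots> \<le> p * K + (1 - p) * K"
      using p b1[OF that] b2[OF that] by (intro add_mono mult_left_mono) auto
    finally show ?thesis by (simp add: algebra_simps)
  qed
  have int_g: "integrable ?B g"
    by (rule integrable_const_bound[where B=K])
       (auto intro!: eventually_mono[OF AE_beta_distribution] K simp del: AE_conj_iff)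
  have int_r: "integrable ?B ?r"
  proof (rule integrable_const_bound[where B=K])
    show "AE x in ?B. norm (?r x) \<le> K"
      using b3 by (intro eventually_mono[OF AE_beta_distribution]) blast
  qed measurable
  define w where "w x = x powr (p - 1) * (1 - x) powr (- p)" for x :: real
  define F where "F x = w x *\<^sub>R (G x - (1 - x) *\<^sub>R G 0 - x *\<^sub>R G 1)" for x
  define d where "d x = g x - ?r x" for x
  have int_d: "integrable ?B d"
    unfolding d_def using int_g int_r by auto
  define c where "c = Gamma (p + (1 - p)) / (Gamma p * Gamma (1 - p))"
  have c: "c > 0" using p by (simp add: c_def Gamma_real_pos)
  have B: "?B = density lborel (\<lambda>x. ennreal (indicator {0..1} x * (c * w x)))"
    by (simp add: beta_distribution_def c_def w_def mult.assoc)
  have wd: "(\<lambda>x. (indicator {0..1} x * (c * w x)) *\<^sub>R d x) = (\<lambda>x. c *\<^sub>R (indicator {0..1} x *\<^sub>R (w x *\<^sub>R d x)))"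
    by (auto simp: fun_eq_iff)
  have [measurable]: "d \<in> borel_measurable borel" "w \<in> borel_measurable borel"
    using int_d unfolding w_def by auto
  have si: "set_integrable lborel {0..1} (\<lambda>x. w x *\<^sub>R d x)"
  proof -
    have "integrable lborel (\<lambda>x. (indicator {0..1} x * (c * w x)) *\<^sub>R d x)"
      using int_d c unfolding B by (subst (asm) integrable_density) (auto simp: w_def)
    then have "integrable lborel (\<lambda>x. (1 / c) *\<^sub>R (c *\<^sub>R (indicator {0..1} x *\<^sub>R (w x *\<^sub>R d x))))"
      unfolding wd by (rule integrable_scaleR_right)
    then show ?thesis
      using c by (simp add: set_integrable_def)
  qed
  have "((\<lambda>x. w x *\<^sub>R d x) has_integral (F 1 - F 0)) {0..1}"
  proof (rule fundamental_theorem_of_calculus_interior)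
    fix x :: real assume x: "x \<in> {0<..<1}"
    have "x powr (p - 1 - 1) = x powr (p - 1) / x"
      "(1 - x) powr (- p - 1) = (1 - x) powr (- p) / (1 - x)"
      using x by (auto simp: powr_diff power2_eq_square)
    then have w': "(w has_real_derivative w x * ((p - 1) / x + p / (1 - x))) (at x)"
      unfolding w_def using x
      by (auto intro!: derivative_eq_intros simp: algebra_simps)
    have "((\<lambda>x. G x - (1 - x) *\<^sub>R G 0 - x *\<^sub>R G 1) has_vector_derivative
        (g x - (- 1) *\<^sub>R G 0 - 1 *\<^sub>R G 1)) (at x)"
      by (auto intro!: derivative_eq_intros G)
    from has_vector_derivative_scaleR[OF w' this]
    have "(F has_vector_derivative (w x *\<^sub>R (g x + G 0 - G 1)
        + (w x * ((p - 1) / x + p / (1 - x))) *\<^sub>R (G x - (1 - x) *\<^sub>R G 0 - x *\<^sub>R G 1))) (at x)"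
      by (simp add: F_def[abs_def])
    also have "w x *\<^sub>R (g x + G 0 - G 1)
        + (w x * ((p - 1) / x + p / (1 - x))) *\<^sub>R (G x - (1 - x) *\<^sub>R G 0 - x *\<^sub>R G 1)
        = w x *\<^sub>R ((g x + G 0 - G 1)
        + ((p - 1) / x + p / (1 - x)) *\<^sub>R (G x - (1 - x) *\<^sub>R G 0 - x *\<^sub>R G 1))"
      by (simp add: scaleR_add_right)
    also have "(g x + G 0 - G 1)
        + ((p - 1) / x + p / (1 - x)) *\<^sub>R (G x - (1 - x) *\<^sub>R G 0 - x *\<^sub>R G 1) = d x"
    proof -
      define A B q where "A = G x - G 0" and "B = G 1 - G x" and "q = (p - 1) / x + p / (1 - x)"
      have q: "q * (1 - x) = (p - 1) / x + 1" "q * x = p / (1 - x) - 1"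
        using x by (simp_all add: q_def divide_simps) (simp_all add: algebra_simps)
      have "G x - (1 - x) *\<^sub>R G 0 - x *\<^sub>R G 1 = (1 - x) *\<^sub>R A - x *\<^sub>R B"
        by (simp add: A_def B_def algebra_simps)
      then have "q *\<^sub>R (G x - (1 - x) *\<^sub>R G 0 - x *\<^sub>R G 1)
          = ((p - 1) / x + 1) *\<^sub>R A - (p / (1 - x) - 1) *\<^sub>R B"
        by (simp only: scaleR_diff_right scaleR_scaleR q)
      also have "\<dots> = A + B - (p *\<^sub>R (B /\<^sub>R (1 - x)) + (1 - p) *\<^sub>R (A /\<^sub>R x))"
        by (simp add: scaleR_left_distrib scaleR_left_diff_distrib divide_inverse algebra_simps)
      finally show ?thesis
        by (simp add: d_def q_def[symmetric] A_def B_def)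
    qed
    finally show "(F has_vector_derivative w x *\<^sub>R d x) (at x)" .
  next
    have F0: "F 0 = 0" "F 1 = 0" by (simp_all add: F_def w_def)
    (* This bound makes F continuous at 0 and 1, although the factor w is
       unbounded near both points. *)
    have bound: "norm (F x) \<le> 2 * K * (x powr p * (1 - x) powr (1 - p))" if x: "x \<in> {0..1}" for x
    proof (cases "x = 0 \<or> x = 1")
      case False
      with x have x: "0 < x" "x < 1" by auto
      have w: "0 \<le> w x" by (simp add: w_def)
      have eq: "G x - (1 - x) *\<^sub>R G 0 - x *\<^sub>R G 1 = (1 - x) *\<^sub>R (G x - G 0) - x *\<^sub>R (G 1 - G x)"
        by (simp add: algebra_simps)
      have "norm (F x) = w x * norm ((1 - x) *\<^sub>R (G x - G 0) - x *\<^sub>R (G 1 - G x))"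
        using w by (simp add: F_def eq)
      also have "\<dots> \<le> w x * ((1 - x) * norm (G x - G 0) + x * norm (G 1 - G x))"
        using x w by (intro mult_left_mono order_trans[OF norm_triangle_ineq4]) auto
      also have "\<dots> \<le> w x * ((1 - x) * (K * x) + x * (K * (1 - x)))"
        using lip[of 0 x] lip[of x 1] x w
        by (intro mult_left_mono add_mono) auto
      also have "\<dots> = 2 * K * ((x powr (p - 1) * x) * ((1 - x) powr (- p) * (1 - x)))"
        by (simp add: w_def algebra_simps)
      also have "x powr (p - 1) * x = x powr p"
        using x by (simp add: powr_diff)
      also have "(1 - x) powr (- p) * (1 - x) = (1 - x) powr (1 - p)"
        using x by (simp add: powr_diff powr_minus field_simps)
      finally show ?thesis .
    qed (auto simp: F0)
    show "continuous_on {0..1} F"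
      unfolding continuous_on_eq_continuous_within
    proof
      fix x :: real assume x: "x \<in> {0..1}"
      show "continuous (at x within {0..1}) F"
      proof (cases "x = 0 \<or> x = 1")
        case True
        have lim: "((\<lambda>y. 2 * K * (y powr p * (1 - y) powr (1 - p))) \<longlongrightarrow>
              2 * K * (x powr p * (1 - x) powr (1 - p))) (at x within {0..1})"
          using p x by (intro tendsto_intros tendsto_powr')
            (auto simp: eventually_at_filter)
        have "(F \<longlongrightarrow> 0) (at x within {0..1})"
          by (rule Lim_null_comparison[OF _ lim[THEN tendsto_eq_rhs]])
             (use True bound in \<open>auto simp: eventually_at_filter\<close>)
        then show ?thesis using True F0 by (auto simp: continuous_within)
      next
        case False
        then show ?thesis using x contG[of UNIV] unfolding F_def w_def
          by (intro continuous_intros)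
             (auto simp: continuous_on_eq_continuous_within intro: continuous_at_imp_continuous_within)
      qed
    qed
  qed simp
  then have "integral {0..1} (\<lambda>x. w x *\<^sub>R d x) = 0"
    by (simp add: integral_unique F_def w_def)
  then have "(\<integral>x\<in>{0..1}. w x *\<^sub>R d x \<partial>lborel) = 0"
    using set_borel_integral_eq_integral(2)[OF si] by simp
  then have "(\<integral>x. d x \<partial>?B) = 0"
    unfolding B using c
    by (subst integral_density)
       (auto simp: w_def set_lebesgue_integral_def wd[unfolded w_def] simp del: scaleR_scaleR)
  then show ?thesis
    using int_g int_r by (simp add: d_def)
qed

lemma real_distribution_beta:
  assumes "0 < p" "p < 1"
  shows "real_distribution (beta_distribution p (1 - p))"
  using assms unfolding real_distribution_def real_distribution_axioms_def
  by (simp add: prob_space_beta_distribution)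

lemma cmod_iexp_minus_1: "cmod (iexp x - 1) \<le> \<bar>x\<bar>"
  using iexp_approx1[of x 0] by simp

lemma has_vector_derivative_iexp:
  "((\<lambda>x. iexp (c + d * x)) has_vector_derivative \<i> * of_real d * iexp (c + d * x)) (at x within S)"
proof -
  have "((\<lambda>z. exp (\<i> * (of_real c + of_real d * z))) has_field_derivative
      \<i> * of_real d * exp (\<i> * (of_real c + of_real d * of_real x))) (at (of_real x))"
    by (auto intro!: derivative_eq_intros)
  from has_vector_derivative_real_field[OF this, of S] show ?thesis by simp
qed

lemma integral_iexp_Icc:
  assumes "0 \<le> l" "d \<noteq> 0"
  shows "(CLINT u|lborel. indicator {0..l} u *\<^sub>R iexp (c + d * u)) = (iexp (c + d * l) - iexp c) / (\<i> * of_real d)"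
proof -
  have "(CLINT u|lborel. indicator {0..l} u *\<^sub>R iexp (c + d * u))
    = iexp (c + d * l) / (\<i> * of_real d) - iexp (c + d * 0) / (\<i> * of_real d)"
  proof (rule integral_FTC_atLeastAtMost)
    fix x
    have "((\<lambda>x. iexp (c + d * x) * (1 / (\<i> * of_real d))) has_vector_derivative
       (\<i> * of_real d * iexp (c + d * x)) * (1 / (\<i> * of_real d))) (at x within {0..l})"
      by (intro has_vector_derivative_mult_left has_vector_derivative_iexp)
    then show "((\<lambda>x. iexp (c + d * x) / (\<i> * of_real d)) has_vector_derivative iexp (c + d * x)) (at x within {0..l})"
      using assms by simp
  qed (use assms in \<open>auto intro!: continuous_intros\<close>)
  then show ?thesis by (simp add: diff_divide_distrib)
qed

text \<open>The integral form of the stick-breaking property of \<open>\<beta>(p,1-p)\<close>, in the variable \<open>u = W l\<close>.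
  After an exchange of the integrals, the inner integrals of the exponentials over \<open>u\<close> are the two
  difference quotients in \<open>beta_stein_identity\<close> for \<open>G(x) = exp(\<i>\<theta>lx) / (\<i>\<theta>)\<close>.\<close>
lemma char_beta_renewal:
  assumes p: "0 < p" "p < 1" and l: "0 \<le> l"
  shows "(CLINT u|lborel. indicator {0..l} u *\<^sub>R ((p * iexp (\<theta> * (l - u)) + of_real (1 - p))
             * char (beta_distribution p (1 - p)) (\<theta> * u)))
         = l * char (beta_distribution p (1 - p)) (\<theta> * l)"
    (is "?L = _ * char ?B _")
proof (cases "\<theta> = 0")
  case True
  interpret real_distribution ?B using p by (rule real_distribution_beta)
  show ?thesis using l True by (simp add: char_zero scaleR_conv_of_real)
next
  case False
  interpret B: real_distribution ?B using p by (rule real_distribution_beta)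
  interpret pair_sigma_finite lborel ?B ..
  define f where "f u x = indicator {0..l} u *\<^sub>R
     (p * iexp (\<theta> * (l - u)) * iexp (\<theta> * u * x) + of_real (1 - p) * iexp (\<theta> * u * x))" for u x
  have f_bound: "norm (p * iexp (\<theta> * (l - u)) * iexp (\<theta> * u * x) + of_real (1 - p) * iexp (\<theta> * u * x)) \<le> 1" for u x
    using p norm_triangle_ineq[of "p * iexp (\<theta> * (l - u)) * iexp (\<theta> * u * x)" "of_real (1 - p) * iexp (\<theta> * u * x)"]
    by (simp add: norm_mult del: of_real_diff)
  have [measurable]: "case_prod f \<in> borel_measurable (lborel \<Otimes>\<^sub>M ?B)"
    unfolding f_def by measurable
  have int: "integrable (lborel \<Otimes>\<^sub>M ?B) (case_prod f)"
  proof -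
    have "emeasure (lborel \<Otimes>\<^sub>M ?B) ({0..l} \<times> space ?B) = ennreal l"
      using l by (subst B.emeasure_pair_measure_Times) (simp_all add: B.emeasure_space_1[simplified])
    moreover have "{0..l} \<times> space ?B \<in> sets (lborel \<Otimes>\<^sub>M ?B)" by measurable
    moreover have "(\<lambda>z. p * iexp (\<theta> * (l - fst z)) * iexp (\<theta> * fst z * snd z)
        + of_real (1 - p) * iexp (\<theta> * fst z * snd z)) \<in> borel_measurable (lborel \<Otimes>\<^sub>M ?B)" by measurable
    ultimately have "integrable (lborel \<Otimes>\<^sub>M ?B) (\<lambda>z. indicator ({0..l} \<times> space ?B) z *\<^sub>R
       (p * iexp (\<theta> * (l - fst z)) * iexp (\<theta> * fst z * snd z) + of_real (1 - p) * iexp (\<theta> * fst z * snd z)))"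
      by (intro integrableI_bounded_set_indicator[where B=1]) (simp_all only: ennreal_less_top f_bound, simp_all)
    then show ?thesis
      by (rule back_subst[where P="integrable _"]) (simp add: fun_eq_iff f_def indicator_times)
  qed
  have "?L = (CLINT u|lborel. CLINT x|?B. f u x)"
  proof (rule Bochner_Integration.integral_cong[OF refl])
    fix u
    have "(CLINT x|?B. f u x) = (CLINT x|?B. (indicator {0..l} u *\<^sub>R
      (p * iexp (\<theta> * (l - u)) + of_real (1 - p))) * iexp (\<theta> * u * x))"
      by (rule Bochner_Integration.integral_cong) (simp_all only: f_def distrib_right mult_scaleR_left)
    also have "\<dots> = (indicator {0..l} u *\<^sub>R
      (p * iexp (\<theta> * (l - u)) + of_real (1 - p))) * char ?B (\<theta> * u)"
      unfolding char_def by (rule integral_mult_right_zero)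
    finally show "indicator {0..l} u *\<^sub>R ((p * iexp (\<theta> * (l - u)) + of_real (1 - p))
             * char (beta_distribution p (1 - p)) (\<theta> * u)) = (CLINT x|?B. f u x)"
      by (simp only: mult_scaleR_left)
  qed
  also have "\<dots> = (CLINT x|?B. CLINT u|lborel. f u x)"
    by (rule Fubini_integral[OF int, symmetric])
  also have "\<dots> = (CLINT x|?B. p *\<^sub>R ((iexp (\<theta> * l * 1) / (\<i> * \<theta>) - iexp (\<theta> * l * x) / (\<i> * \<theta>)) /\<^sub>R (1 - x))
      + (1 - p) *\<^sub>R ((iexp (\<theta> * l * x) / (\<i> * \<theta>) - iexp (\<theta> * l * 0) / (\<i> * \<theta>)) /\<^sub>R x))"
  proof (rule integral_cong_AE)
    show "AE x in ?B. (CLINT u|lborel. f u x) =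
      p *\<^sub>R ((iexp (\<theta> * l * 1) / (\<i> * \<theta>) - iexp (\<theta> * l * x) / (\<i> * \<theta>)) /\<^sub>R (1 - x))
      + (1 - p) *\<^sub>R ((iexp (\<theta> * l * x) / (\<i> * \<theta>) - iexp (\<theta> * l * 0) / (\<i> * \<theta>)) /\<^sub>R x)"
    proof (rule eventually_mono[OF AE_beta_distribution])
      fix x :: real assume x: "0 < x \<and> x < 1"
      have int': "integrable lborel (\<lambda>u. indicator {0..l} u *\<^sub>R iexp (c + d * u))" for c d
        using l by (intro integrableI_bounded_set_indicator[where B=1]) auto
      have "f u x = p * (indicator {0..l} u *\<^sub>R iexp (\<theta> * l + (- \<theta> * (1 - x)) * u))
             + of_real (1 - p) * (indicator {0..l} u *\<^sub>R iexp (0 + (\<theta> * x) * u))" for u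
      proof -
        have "\<theta> * (l - u) + \<theta> * u * x = \<theta> * l + (- \<theta> * (1 - x)) * u" "\<theta> * u * x = 0 + (\<theta> * x) * u"
          by (simp_all add: algebra_simps)
        then have "iexp (\<theta> * (l - u)) * iexp (\<theta> * u * x) = iexp (\<theta> * l + (- \<theta> * (1 - x)) * u)"
          "iexp (\<theta> * u * x) = iexp (0 + (\<theta> * x) * u)"
          by (simp_all only: mult_exp_exp distrib_left[symmetric] of_real_add[symmetric])
        moreover have "f u x = p * (indicator {0..l} u *\<^sub>R (iexp (\<theta> * (l - u)) * iexp (\<theta> * u * x)))
             + of_real (1 - p) * (indicator {0..l} u *\<^sub>R iexp (\<theta> * u * x))"
          by (simp only: f_def scaleR_right_distrib mult_scaleR_right mult.assoc)
        ultimately show ?thesis by simp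
      qed
      then have "(CLINT u|lborel. f u x) = p * (CLINT u|lborel. indicator {0..l} u *\<^sub>R iexp (\<theta> * l + (- \<theta> * (1 - x)) * u))
             + of_real (1 - p) * (CLINT u|lborel. indicator {0..l} u *\<^sub>R iexp (0 + (\<theta> * x) * u))"
        by (simp only: Bochner_Integration.integral_add[OF integrable_mult_right[OF int'] integrable_mult_right[OF int']] integral_mult_right_zero)
      also have "(CLINT u|lborel. indicator {0..l} u *\<^sub>R iexp (\<theta> * l + (- \<theta> * (1 - x)) * u))
        = (iexp (\<theta> * l + (- \<theta> * (1 - x)) * l) - iexp (\<theta> * l)) / (\<i> * of_real (- \<theta> * (1 - x)))"
        using l x False by (intro integral_iexp_Icc) auto
      also have "(CLINT u|lborel. indicator {0..l} u *\<^sub>R iexp (0 + (\<theta> * x) * u))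
        = (iexp (0 + (\<theta> * x) * l) - iexp 0) / (\<i> * of_real (\<theta> * x))"
        using l x False by (intro integral_iexp_Icc) auto
      also have "\<theta> * l + (- \<theta> * (1 - x)) * l = \<theta> * l * x" by (simp add: algebra_simps)
      also have "0 + (\<theta> * x) * l = \<theta> * l * x" by (simp add: algebra_simps)
      also have "(iexp (\<theta> * l * x) - iexp (\<theta> * l)) / (\<i> * of_real (- \<theta> * (1 - x)))
          = (iexp (\<theta> * l * 1) / (\<i> * \<theta>) - iexp (\<theta> * l * x) / (\<i> * \<theta>)) /\<^sub>R (1 - x)"
      proof -
        have aux: "(A - B) / (k * (- t * y)) = inverse y * (B / (k * t) - A / (k * t))" for A B k t y :: complex
          by (simp add: divide_inverse algebra_simps)
        have "complex_of_real (- \<theta> * (1 - x)) = - of_real \<theta> * of_real (1 - x)" by simp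
        then show ?thesis by (simp only: scaleR_conv_of_real aux of_real_inverse mult_1_right)
      qed
      also have "(iexp (\<theta> * l * x) - iexp 0) / (\<i> * of_real (\<theta> * x))
          = (iexp (\<theta> * l * x) / (\<i> * \<theta>) - iexp (\<theta> * l * 0) / (\<i> * \<theta>)) /\<^sub>R x"
        by (simp add: scaleR_conv_of_real divide_inverse algebra_simps)
      finally show "(CLINT u|lborel. f u x) =
         p *\<^sub>R ((iexp (\<theta> * l * 1) / (\<i> * \<theta>) - iexp (\<theta> * l * x) / (\<i> * \<theta>)) /\<^sub>R (1 - x))
         + (1 - p) *\<^sub>R ((iexp (\<theta> * l * x) / (\<i> * \<theta>) - iexp (\<theta> * l * 0) / (\<i> * \<theta>)) /\<^sub>R x)"
        by (simp only: scaleR_conv_of_real)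
    qed
    have "case_prod (\<lambda>x u. f u x) \<in> borel_measurable (?B \<Otimes>\<^sub>M lborel)"
      unfolding f_def by measurable
    then show "(\<lambda>x. CLINT u|lborel. f u x) \<in> borel_measurable ?B"
      by (rule lborel.borel_measurable_lebesgue_integral)
  qed measurable
  also have "\<dots> = (CLINT x|?B. l * iexp (\<theta> * l * x))"
  proof (rule beta_stein_identity[OF p, symmetric])
    show "((\<lambda>x. iexp (\<theta> * l * x) / (\<i> * \<theta>)) has_vector_derivative l * iexp (\<theta> * l * x)) (at x)" for x
      using has_vector_derivative_mult_left[OF has_vector_derivative_iexp[of 0 "\<theta> * l" x UNIV], of "1 / (\<i> * \<theta>)"] False
      by simp
  qed (auto intro!: continuous_intros)
  also have "\<dots> = l * char ?B (\<theta> * l)"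
    by (simp add: char_def)
  finally show ?thesis .
qed

text \<open>The renewal identity, transported to the interval left of \<open>x\<close> by \<open>u = x - v\<close>.\<close>
lemma char_beta_renewal_left:
  assumes p: "0 < p" "p < 1" and "a \<le> x"
  shows "(CLINT v|lborel. indicator {a<..x} v *\<^sub>R ((p * iexp (\<theta> * (v - a)) + of_real (1 - p))
             * char (beta_distribution p (1 - p)) (\<theta> * (x - v))))
         = of_real (x - a) * char (beta_distribution p (1 - p)) (\<theta> * (x - a))"
    (is "?L = _ * char ?B _")
proof -
  interpret real_distribution ?B using p by (rule real_distribution_beta)
  have "?L = (CLINT u|lborel. indicator {a<..x} (x + -1 * u) *\<^sub>R ((p * iexp (\<theta> * ((x + -1 * u) - a)) + of_real (1 - p))
             * char ?B (\<theta> * (x - (x + -1 * u)))))"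
    by (subst lborel_integral_real_affine[where c="-1" and t=x]) simp_all
  also have "\<dots> = (CLINT u|lborel. indicator {0..x - a} u *\<^sub>R ((p * iexp (\<theta> * ((x - a) - u)) + of_real (1 - p))
             * char ?B (\<theta> * u)))"
  proof (rule integral_cong_AE)
    show "AE u in lborel. indicator {a<..x} (x + -1 * u) *\<^sub>R ((p * iexp (\<theta> * ((x + -1 * u) - a)) + of_real (1 - p))
             * char ?B (\<theta> * (x - (x + -1 * u)))) = indicator {0..x - a} u *\<^sub>R ((p * iexp (\<theta> * ((x - a) - u)) + of_real (1 - p))
             * char ?B (\<theta> * u))"
      using AE_lborel_singleton[of "x - a"]
      by eventually_elim (auto simp: indicator_def algebra_simps)
  qed measurable
  also have "\<dots> = of_real (x - a) * char ?B (\<theta> * (x - a))"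
    using assms by (subst char_beta_renewal) auto
  finally show ?thesis .
qed

text \<open>The renewal identity, transported to the interval right of \<open>x\<close> by \<open>u = v - x\<close>.\<close>
lemma char_beta_renewal_right:
  assumes p: "0 < p" "p < 1" and "x \<le> b"
  shows "(CLINT v|lborel. indicator {x<..b} v *\<^sub>R ((p * iexp (\<theta> * (b - v)) + of_real (1 - p))
             * char (beta_distribution p (1 - p)) (\<theta> * (v - x))))
         = of_real (b - x) * char (beta_distribution p (1 - p)) (\<theta> * (b - x))"
    (is "?L = _ * char ?B _")
proof -
  interpret real_distribution ?B using p by (rule real_distribution_beta)
  have "?L = (CLINT u|lborel. indicator {x<..b} (x + 1 * u) *\<^sub>R ((p * iexp (\<theta> * (b - (x + 1 * u))) + of_real (1 - p))
             * char ?B (\<theta> * ((x + 1 * u) - x))))"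
    by (subst lborel_integral_real_affine[where c=1 and t=x]) simp_all
  also have "\<dots> = (CLINT u|lborel. indicator {0..b - x} u *\<^sub>R ((p * iexp (\<theta> * ((b - x) - u)) + of_real (1 - p))
             * char ?B (\<theta> * u)))"
  proof (rule integral_cong_AE)
    show "AE u in lborel. indicator {x<..b} (x + 1 * u) *\<^sub>R ((p * iexp (\<theta> * (b - (x + 1 * u))) + of_real (1 - p))
             * char ?B (\<theta> * ((x + 1 * u) - x))) = indicator {0..b - x} u *\<^sub>R ((p * iexp (\<theta> * ((b - x) - u)) + of_real (1 - p))
             * char ?B (\<theta> * u))"
      using AE_lborel_singleton[of "0::real"]
      by eventually_elim (auto simp: indicator_def algebra_simps)
  qed measurable
  also have "\<dots> = of_real (b - x) * char ?B (\<theta> * (b - x))"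
    using assms by (subst char_beta_renewal) auto
  finally show ?thesis .
qed

section \<open>The comparison relation after the first point\<close>

lemma ex_first_Suc:
  fixes P Q :: "nat \<Rightarrow> bool"
  shows "(\<exists>j. P j \<and> (\<forall>i<j. \<not> P i) \<and> Q j) \<longleftrightarrow>
     (if P 0 then Q 0 else \<exists>j. P (Suc j) \<and> (\<forall>i<j. \<not> P (Suc i)) \<and> Q (Suc j))"
proof -
  have "(\<exists>j. R j) \<longleftrightarrow> R 0 \<or> (\<exists>j. R (Suc j))" for R :: "nat \<Rightarrow> bool"
    by (metis not0_implies_Suc)
  from this[of "\<lambda>j. P j \<and> (\<forall>i<j. \<not> P i) \<and> Q j"] show ?thesis
    by (auto simp: All_less_Suc2)
qed

text \<open>Replaces \<open>LEAST\<close> by a countable combination of elementary conditions, which serves both the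
  measurability proofs and the removal of the first element of a sequence.\<close>
lemma ex_Least_iff:
  fixes P Q :: "nat \<Rightarrow> bool"
  shows "(\<exists>j. P j) \<and> Q (LEAST j. P j) \<longleftrightarrow> (\<exists>j. P j \<and> (\<forall>i<j. \<not> P i) \<and> Q j)"
proof safe
  fix j assume "P j" "Q (LEAST j. P j)"
  then show "\<exists>j. P j \<and> (\<forall>i<j. \<not> P i) \<and> Q j"
    by (intro exI[of _ "LEAST j. P j"]) (auto intro: LeastI dest: not_less_Least)
next
  fix j assume "P j" "\<forall>i<j. \<not> P i" "Q j"
  moreover from this have "(LEAST j. P j) = j"
    by (intro Least_equality) (auto simp: not_less[symmetric])
  ultimately show "Q (LEAST j. P j)" by simp
qed blast

lemma rec_prec_iff:
  "rec_prec u s y x \<longleftrightarrow>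
     (\<exists>j. u j \<in> {y<..x} \<and> (\<forall>i<j. u i \<notin> {y<..x}) \<and> s j) \<or>
     (\<exists>j. u j \<in> {x<..y} \<and> (\<forall>i<j. u i \<notin> {x<..y}) \<and> \<not> s j)"
  unfolding rec_prec_def
    ex_Least_iff[of "\<lambda>j. u j \<in> {y<..x}" s]
    ex_Least_iff[of "\<lambda>j. u j \<in> {x<..y}" "\<lambda>j. \<not> s j"]
  by auto

text \<open>If the new first point \<open>v\<close> separates \<open>x\<close> and \<open>y\<close>, its sign decides; otherwise the first
  separating point is found in the old sequence.\<close>
lemma rec_prec_case_nat:
  "rec_prec (case_nat v u) (case_nat t s) y x \<longleftrightarrow>
     (if v \<in> {y<..x} then t else if v \<in> {x<..y} then \<not> t else rec_prec u s y x)"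
  unfolding rec_prec_iff
    ex_first_Suc[of "\<lambda>j. case_nat v u j \<in> {y<..x}" "case_nat t s"]
    ex_first_Suc[of "\<lambda>j. case_nat v u j \<in> {x<..y}" "\<lambda>j. \<not> case_nat t s j"]
  by auto

lemma measurable_rec_prec:
  assumes f: "f \<in> N \<rightarrow>\<^sub>M (\<Pi>\<^sub>M j\<in>UNIV. borel)"
    and t: "t \<in> N \<rightarrow>\<^sub>M (\<Pi>\<^sub>M j\<in>UNIV. count_space UNIV)"
    and [measurable]: "a \<in> borel_measurable N" "b \<in> borel_measurable N"
  shows "Measurable.pred N (\<lambda>\<omega>. rec_prec (f \<omega>) (t \<omega>) (a \<omega>) (b \<omega>))"
proof -
  have [measurable]: "(\<lambda>\<omega>. f \<omega> j) \<in> borel_measurable N" for j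
    using measurable_compose[OF f measurable_component_singleton, of j] by simp
  have [measurable]: "Measurable.pred N (\<lambda>\<omega>. t \<omega> j)" for j
    using measurable_compose[OF t measurable_component_singleton, of j] by simp
  show ?thesis
    unfolding rec_prec_iff greaterThanAtMost_iff by measurable
qed

lemma measurable_rec_prec_left [measurable]:
  "Measurable.pred borel (\<lambda>y. rec_prec u s y x)"
  by (rule measurable_rec_prec) (auto simp: space_PiM)

text \<open>The interval is half-open so that cutting it at a point gives an exact partition.\<close>
definition prec_mass ::
    "(nat \<Rightarrow> real) \<Rightarrow> (nat \<Rightarrow> bool) \<Rightarrow> real \<Rightarrow> real \<Rightarrow> real \<Rightarrow> real" where
  "prec_mass u s x a b = measure lborel {y \<in> {a..<b}. rec_prec u s y x}"

lemma measurable_prec_mass: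
  assumes f: "f \<in> N \<rightarrow>\<^sub>M (\<Pi>\<^sub>M j\<in>UNIV. borel)"
    and t: "t \<in> N \<rightarrow>\<^sub>M (\<Pi>\<^sub>M j\<in>UNIV. count_space UNIV)"
    and [measurable]: "c \<in> borel_measurable N" "a \<in> borel_measurable N" "b \<in> borel_measurable N"
  shows "(\<lambda>\<omega>. prec_mass (f \<omega>) (t \<omega>) (c \<omega>) (a \<omega>) (b \<omega>)) \<in> borel_measurable N"
proof -
  have [measurable]: "Measurable.pred (N \<Otimes>\<^sub>M lborel)
      (\<lambda>z. rec_prec (f (fst z)) (t (fst z)) (snd z) (c (fst z)))"
    by (intro measurable_rec_prec measurable_compose[OF _ f] measurable_compose[OF _ t]) measurable
  have "(\<lambda>\<omega>. emeasure lborel {y \<in> {a \<omega>..<b \<omega>}. rec_prec (f \<omega>) (t \<omega>) y (c \<omega>)}) \<in> borel_measurable N"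
    by (rule lborel.measurable_emeasure)
       (simp, unfold mem_Collect_eq atLeastLessThan_iff, measurable)
  then show ?thesis
    unfolding prec_mass_def measure_def by measurable
qed

lemma fmeasurable_Ico: "{a..<b::real} \<in> fmeasurable lborel"
  by (rule fmeasurableI2[of "cbox a b"])
     (auto intro!: fmeasurableI simp: emeasure_lborel_cbox_finite simp del: box_real)

lemma fmeasurable_prec: "{y \<in> {a..<b}. rec_prec u s y x} \<in> fmeasurable lborel"
  by (rule fmeasurableI2[OF fmeasurable_Ico]) auto

lemma prec_mass_nonneg: "0 \<le> prec_mass u s x a b"
  by (simp add: prec_mass_def)

lemma prec_mass_le:
  assumes "a \<le> b"
  shows "prec_mass u s x a b \<le> b - a"
proof -
  have "prec_mass u s x a b \<le> measure lborel {a..<b}"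
    unfolding prec_mass_def
    by (rule measure_mono_fmeasurable) (auto intro: fmeasurable_Ico)
  then show ?thesis using assms by simp
qed

lemma rec_phi_eq_prec_mass: "rec_phi u s x = prec_mass u s x 0 1"
proof -
  have "rec_phi u s x = measure lborel {y \<in> {0..1}. rec_prec u s y x}"
    unfolding rec_phi_def leb_unit_def
    by (subst measure_uniform_measure) (auto intro!: arg_cong[of _ _ "measure lborel"])
  also have "\<dots> = prec_mass u s x 0 1"
    unfolding prec_mass_def
  proof (rule measure_eq_AE)
    show "AE y in lborel. y \<in> {y \<in> {0..1}. rec_prec u s y x} \<longleftrightarrow> y \<in> {y \<in> {0..<1}. rec_prec u s y x}"
      using AE_lborel_singleton[of "1::real"] by eventually_elim auto
  qed auto
  finally show ?thesis .
qed

text \<open>A first point inside the interval separates \<open>x\<close> from the whole block that lies beyond the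
  point, seen from \<open>x\<close>; the sign decides about this block, and the rest of the interval is left
  to the old sequence.\<close>
lemma prec_mass_case_nat:
  assumes "a \<le> x" "x \<le> b"
  shows "prec_mass (case_nat v u) (case_nat t s) x a b =
    (if v \<in> {a<..x} then (if t then v - a else 0) + prec_mass u s x v b
     else if v \<in> {x<..b} then (if t then 0 else b - v) + prec_mass u s x a v
     else prec_mass u s x a b)"
proof -
  let ?A = "{y \<in> {a..<b}. rec_prec (case_nat v u) (case_nat t s) y x}"
  let ?R = "\<lambda>a b. {y \<in> {a..<b}. rec_prec u s y x}"
  have fin: "?R c d \<in> fmeasurable lborel" "{c..<d} \<in> fmeasurable lborel" for c d
      by (rule fmeasurable_prec fmeasurable_Ico)+
  consider "v \<in> {a<..x}" | "v \<in> {x<..b}" | "v \<notin> {a<..x}" "v \<notin> {x<..b}" by blast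
  then show ?thesis
  proof cases
    case 1
    then have "?A = (if t then {a..<v} else {}) \<union> ?R v b"
      using assms by (auto simp: rec_prec_case_nat)
    moreover have dj: "{a..<v} \<inter> ?R v b = {}" by auto
    ultimately have "prec_mass (case_nat v u) (case_nat t s) x a b
        = measure lborel (if t then {a..<v} else {}) + prec_mass u s x v b"
      unfolding prec_mass_def using measure_Un3[OF fin(2)[of a v] fin(1)[of v b]] dj by auto
    then show ?thesis using 1 by auto
  next
    case 2
    then have "?A = (if t then {} else {v..<b}) \<union> ?R a v"
      using assms by (auto simp: rec_prec_case_nat)
    moreover have dj: "{v..<b} \<inter> ?R a v = {}" by auto
    ultimately have "prec_mass (case_nat v u) (case_nat t s) x a b
        = measure lborel (if t then {} else {v..<b}) + prec_mass u s x a v"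
      unfolding prec_mass_def using measure_Un3[OF fin(2)[of v b] fin(1)[of a v]] dj by auto
    then show ?thesis using 2 by auto
  next
    case 3
    then have "?A = ?R a b"
      using assms by (auto simp: rec_prec_case_nat)
    then show ?thesis using 3 by (auto simp: prec_mass_def)
  qed
qed

section \<open>The splitting equation and its unique solution\<close>

text \<open>Let \<open>k a b\<close> stand for the characteristic function, at \<open>\<theta>\<close>, of the mass of the points of
  \<open>[a,b)\<close> that precede \<open>x\<close>. Then this is its conditional value, given that the first point of
  the sequence is \<open>v\<close>.\<close>
definition split_step ::
  "real \<Rightarrow> real \<Rightarrow> real \<Rightarrow> (real \<Rightarrow> real \<Rightarrow> complex) \<Rightarrow> real \<Rightarrow> real \<Rightarrow> real \<Rightarrow> complex" where
  "split_step \<theta> p x k a b v =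
    (if v \<in> {a<..x} then (of_real p * iexp (\<theta> * (v - a)) + of_real (1 - p)) * k v b
     else if v \<in> {x<..b} then (of_real p + of_real (1 - p) * iexp (\<theta> * (b - v))) * k a v
     else k a b)"

lemma cmod_convex_iexp_le:
  assumes "0 \<le> p" "p \<le> 1"
  shows "cmod (of_real p * iexp s + of_real (1 - p) * iexp t) \<le> 1"
  using assms norm_triangle_ineq[of "of_real p * iexp s" "of_real (1 - p) * iexp t"]
  by (simp add: norm_mult del: of_real_diff)

lemma cmod_split_step_le:
  assumes "0 \<le> p" "p \<le> 1"
  shows "cmod (split_step \<theta> p x k a b v) \<le>
    (if v \<in> {a<..x} then cmod (k v b) else if v \<in> {x<..b} then cmod (k a v) else cmod (k a b))"
  using cmod_convex_iexp_le[OF assms, of "\<theta> * (v - a)" 0]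
    cmod_convex_iexp_le[OF assms, of 0 "\<theta> * (b - v)"]
  by (auto simp: split_step_def norm_mult mult_left_le_one_le simp del: of_real_diff)

lemma split_step_diff:
  "split_step \<theta> p x k a b v - split_step \<theta> p x k' a b v
    = split_step \<theta> p x (\<lambda>a b. k a b - k' a b) a b v"
  by (simp add: split_step_def right_diff_distrib)

text \<open>The coefficients in \<open>split_step\<close> have modulus at most \<open>1\<close>, so the difference of two solutions
  is bounded by its own average over the cut intervals. A cut outside \<open>(a,b]\<close> reproduces the left
  side and is absorbed there. With \<open>L = x - a\<close> and \<open>R = b - x\<close>, the cuts inside contribute
  at most \<open>C\<close> times \<open>2 L R + (L\<^sup>2 + R\<^sup>2) / 2 = 3/4 (L + R)\<^sup>2 - (L - R)\<^sup>2 / 4\<close>.\<close>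
lemma split_step_contraction:
  fixes k k' :: "real \<Rightarrow> real \<Rightarrow> complex"
  assumes p: "0 \<le> p" "p \<le> 1" and ab: "0 \<le> a" "a \<le> x" "x \<le> b" "b \<le> 1"
    and eq: "k a b = (\<integral>v. split_step \<theta> p x k a b v \<partial>leb_unit)"
      "k' a b = (\<integral>v. split_step \<theta> p x k' a b v \<partial>leb_unit)"
    and int: "integrable leb_unit (split_step \<theta> p x k a b)"
      "integrable leb_unit (split_step \<theta> p x k' a b)"
    and C: "\<And>a b. 0 \<le> a \<Longrightarrow> a \<le> x \<Longrightarrow> x \<le> b \<Longrightarrow> b \<le> 1 \<Longrightarrow> cmod (k a b - k' a b) \<le> C * (b - a)"
  shows "cmod (k a b - k' a b) \<le> 3 / 4 * C * (b - a)"
proof (cases "a = b")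
  case True
  then show ?thesis using C[of a b] ab by simp
next
  case False
  interpret prob_space leb_unit by (rule prob_space_leb_unit)
  define D where "D = cmod (k a b - k' a b)"
  (* W v is C times the length of the interval left by a cut at v, and D if v
     does not cut; it is written as a sum so that its integral can be computed. *)
  define W where "W v = D + indicator {a<..x} v * ((C * b - D) + (- C) * v)
      + indicator {x<..b} v * ((- C * a - D) + C * v)" for v
  have intW: "integrable leb_unit (\<lambda>v. indicator {c<..d} v * (s + t * v))"
    if "0 \<le> c" "d \<le> 1" for c d s t :: real
  proof (rule integrable_const_bound[where B="\<bar>s\<bar> + \<bar>t\<bar>"])
    have "norm (indicator {c<..d} v * (s + t * v)) \<le> \<bar>s\<bar> + \<bar>t\<bar>" for v :: real
    proof (cases "v \<in> {c<..d}")
      case True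
      then have "\<bar>t * v\<bar> \<le> \<bar>t\<bar>" using that by (simp add: abs_mult mult_left_le)
      then show ?thesis using True by simp
    qed simp
    then show "AE v in leb_unit. norm (indicator {c<..d} v * (s + t * v)) \<le> \<bar>s\<bar> + \<bar>t\<bar>" by simp
  qed measurable
  have "k a b - k' a b = (\<integral>v. split_step \<theta> p x (\<lambda>a b. k a b - k' a b) a b v \<partial>leb_unit)"
    unfolding split_step_diff[symmetric] using int
    by (subst Bochner_Integration.integral_diff) (simp_all flip: eq)
  then have "D \<le> (\<integral>v. W v \<partial>leb_unit)"
    unfolding D_def
  proof (simp only:, intro integral_norm_bound[THEN order_trans] integral_mono)
    show "integrable leb_unit (\<lambda>v. cmod (split_step \<theta> p x (\<lambda>a b. k a b - k' a b) a b v))"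
      unfolding split_step_diff[symmetric] using int by auto
    show "integrable leb_unit W"
      unfolding W_def using ab by (intro Bochner_Integration.integrable_add intW) auto
    show "cmod (split_step \<theta> p x (\<lambda>a b. k a b - k' a b) a b v) \<le> W v" for v
      using cmod_split_step_le[OF p, of \<theta> x "\<lambda>a b. k a b - k' a b" a b v] C[of v b] C[of a v] ab
      by (auto simp: W_def D_def algebra_simps split: if_splits)
  qed
  also have "\<dots> = D + (x - a) * ((C * b - D) + (- C) * (a + x) / 2)
      + (b - x) * ((- C * a - D) + C * (x + b) / 2)"
  proof -
    have I: "integrable leb_unit (\<lambda>v. indicator {a<..x} v * ((C * b - D) + (- C) * v))"
      "integrable leb_unit (\<lambda>v. indicator {x<..b} v * ((- C * a - D) + C * v))"
      by (rule intW[OF ab(1) order_trans[OF ab(3,4)]] intW[OF order_trans[OF ab(1,2)] ab(4)])+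
    have "(\<integral>v. W v \<partial>leb_unit) = D + (\<integral>v. indicator {a<..x} v * ((C * b - D) + (- C) * v) \<partial>leb_unit)
       + (\<integral>v. indicator {x<..b} v * ((- C * a - D) + C * v) \<partial>leb_unit)"
      unfolding W_def
      by (subst Bochner_Integration.integral_add[OF Bochner_Integration.integrable_add[OF integrable_const I(1)] I(2)],
          subst Bochner_Integration.integral_add[OF integrable_const I(1)])
         (simp add: prob_space[simplified])
    then show ?thesis
      using ab integral_leb_unit_affine[of a x "C * b - D" "- C"]
        integral_leb_unit_affine[of x b "- C * a - D" C] by (simp only:)
  qed
  also have "\<dots> = D - D * (b - a)
      + C * (3 / 4 * ((b - a) * (b - a)) - (x - a - (b - x)) * (x - a - (b - x)) / 4)"
    by (simp add: field_simps)
  finally have "D * (b - a)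
      \<le> C * (3 / 4 * ((b - a) * (b - a)) - (x - a - (b - x)) * (x - a - (b - x)) / 4)"
    by (simp only: diff_add_eq le_diff_eq add_le_cancel_left)
  also have "\<dots> \<le> C * (3 / 4 * ((b - a) * (b - a)))"
  proof (rule mult_left_mono)
    have "0 \<le> C * (b - a)" using C[of a b] ab norm_ge_zero[of "k a b - k' a b"] by linarith
    then show "0 \<le> C" using False ab by (simp add: zero_le_mult_iff)
  qed simp
  finally have "D * (b - a) \<le> (3 / 4 * C * (b - a)) * (b - a)"
    by (simp only: mult_ac)
  moreover have "0 < b - a" using False ab by simp
  ultimately show ?thesis
    unfolding D_def by (rule mult_right_le_imp_le)
qed

text \<open>Iterate the contraction. The assumed bound by a multiple of the length is essential: for
  \<open>\<theta> = 0\<close> every constant function solves the equation.\<close>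
lemma split_step_fixed_point_unique:
  fixes k k' :: "real \<Rightarrow> real \<Rightarrow> complex"
  assumes p: "0 \<le> p" "p \<le> 1"
    and eq: "\<And>a b. 0 \<le> a \<Longrightarrow> a \<le> x \<Longrightarrow> x \<le> b \<Longrightarrow> b \<le> 1 \<Longrightarrow>
        k a b = (\<integral>v. split_step \<theta> p x k a b v \<partial>leb_unit)"
      "\<And>a b. 0 \<le> a \<Longrightarrow> a \<le> x \<Longrightarrow> x \<le> b \<Longrightarrow> b \<le> 1 \<Longrightarrow>
        k' a b = (\<integral>v. split_step \<theta> p x k' a b v \<partial>leb_unit)"
    and int: "\<And>a b. integrable leb_unit (split_step \<theta> p x k a b)"
      "\<And>a b. integrable leb_unit (split_step \<theta> p x k' a b)"
    and C: "\<And>a b. 0 \<le> a \<Longrightarrow> a \<le> x \<Longrightarrow> x \<le> b \<Longrightarrow> b \<le> 1 \<Longrightarrow> cmod (k a b - k' a b) \<le> C * (b - a)"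
    and ab: "0 \<le> a" "a \<le> x" "x \<le> b" "b \<le> 1"
  shows "k a b = k' a b"
proof -
  have "cmod (k a b - k' a b) \<le> ((3 / 4) ^ n * C) * (b - a)"
    if "0 \<le> a" "a \<le> x" "x \<le> b" "b \<le> 1" for n a b
    using that
  proof (induction n arbitrary: a b)
    case (Suc n)
    then show ?case
      using split_step_contraction[OF p Suc.prems eq[OF Suc.prems] int Suc.IH] by (simp add: mult.assoc)
  qed (use C in simp)
  then have "cmod (k a b - k' a b) \<le> ((3 / 4) ^ n * C) * (b - a)" for n
    using ab by blast
  moreover have "(\<lambda>n. ((3 / 4 :: real) ^ n * C) * (b - a)) \<longlonglongrightarrow> (0 * C) * (b - a)"
    by (intro tendsto_intros LIMSEQ_realpow_zero) auto
  ultimately have "cmod (k a b - k' a b) \<le> 0"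
    by (intro LIMSEQ_le_const) auto
  then show ?thesis by simp
qed

lemma integrable_split_step:
  assumes "0 \<le> p" "p \<le> 1"
    and [measurable]: "(\<lambda>v. k v b) \<in> borel_measurable borel" "k a \<in> borel_measurable borel"
    and "\<And>a b. cmod (k a b) \<le> 1"
  shows "integrable leb_unit (split_step \<theta> p x k a b)"
proof -
  interpret prob_space leb_unit by (rule prob_space_leb_unit)
  show ?thesis
  proof (rule integrable_const_bound[where B=1])
    show "AE v in leb_unit. cmod (split_step \<theta> p x k a b v) \<le> 1"
    proof (rule AE_I2)
      show "cmod (split_step \<theta> p x k a b v) \<le> 1" for v
        by (rule order_trans[OF cmod_split_step_le[OF assms(1,2)]]) (simp add: assms(5))
    qed
    show "split_step \<theta> p x k a b \<in> borel_measurable leb_unit"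
      unfolding split_step_def greaterThanAtMost_iff by measurable
  qed
qed

section \<open>The beta solution of the splitting equation\<close>

lemma (in prob_space) norm_integral_le:
  fixes f :: "'a \<Rightarrow> 'b :: {banach, second_countable_topology}"
  assumes "AE x in M. norm (f x) \<le> B" and "0 \<le> B"
  shows "norm (\<integral>x. f x \<partial>M) \<le> B"
proof (cases "integrable M f")
  case True
  then have "(\<integral>x. norm (f x) \<partial>M) \<le> B"
    using assms by (intro integral_le_const) auto
  then show ?thesis using integral_norm_bound[of M f] by linarith
qed (use assms in \<open>simp add: not_integrable_integral_eq\<close>)

lemma (in prob_space) norm_integral_minus_1_le:
  fixes f :: "'a \<Rightarrow> complex"
  assumes f: "integrable M f" and B: "AE x in M. cmod (f x - 1) \<le> B" "0 \<le> B"
  shows "cmod ((\<integral>x. f x \<partial>M) - 1) \<le> B"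
proof -
  have "(\<integral>x. f x \<partial>M) - 1 = (\<integral>x. f x - 1 \<partial>M)"
    using f by (simp add: prob_space)
  then show ?thesis using norm_integral_le[of "\<lambda>x. f x - 1" B] B by simp
qed

text \<open>The characteristic function, at \<open>\<theta>\<close>, of \<open>(x - a) X + (b - x) X'\<close> for independent \<open>X\<close> and
  \<open>X'\<close> with laws \<open>\<beta>(p,1-p)\<close> and \<open>\<beta>(1-p,p)\<close>.\<close>
definition beta_mix_char :: "real \<Rightarrow> real \<Rightarrow> real \<Rightarrow> real \<Rightarrow> real \<Rightarrow> complex" where
  "beta_mix_char \<theta> p x a b = char (beta_distribution p (1 - p)) (\<theta> * (x - a))
      * char (beta_distribution (1 - p) p) (\<theta> * (b - x))"

text \<open>A cut left of \<open>x\<close> changes only the first factor, a cut right of \<open>x\<close> only the second.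
  By the renewal identities the two ranges of cuts contribute \<open>x - a\<close> and \<open>b - x\<close> times the
  product, and the cuts outside \<open>(a,b]\<close> contribute the remaining multiple \<open>1 - (b - a)\<close>.\<close>
lemma beta_mix_char_fixed_point:
  assumes p: "0 < p" "p < 1" and ab: "0 \<le> a" "a \<le> x" "x \<le> b" "b \<le> 1"
  shows "beta_mix_char \<theta> p x a b = (\<integral>v. split_step \<theta> p x (beta_mix_char \<theta> p x) a b v \<partial>leb_unit)"
proof -
  interpret L: prob_space leb_unit by (rule prob_space_leb_unit)
  (* The right factor has the law beta(1 - p, p) = beta(q, 1 - q), so the
     renewal identity applies to it with q in the role of p. *)
  define q where "q = 1 - p"
  have q: "0 < q" "q < 1" "p = 1 - q" using p by (auto simp: q_def)
  define \<phi> \<psi> where "\<phi> = char (beta_distribution p (1 - p))" and "\<psi> = char (beta_distribution q (1 - q))"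
  interpret P: real_distribution "beta_distribution p (1 - p)" using p by (rule real_distribution_beta)
  interpret Q: real_distribution "beta_distribution q (1 - q)" using q(1,2) by (rule real_distribution_beta)
  have mix: "beta_mix_char \<theta> p x a b = \<phi> (\<theta> * (x - a)) * \<psi> (\<theta> * (b - x))" for a b
    by (simp add: beta_mix_char_def \<phi>_def \<psi>_def q_def)
  have [measurable]: "\<phi> \<in> borel_measurable borel" "\<psi> \<in> borel_measurable borel"
    unfolding \<phi>_def \<psi>_def by measurable
  have le1: "cmod (\<phi> t) \<le> 1" "cmod (\<psi> t) \<le> 1" for t
    unfolding \<phi>_def \<psi>_def by (rule P.cmod_char_le_1 Q.cmod_char_le_1)+
  define f where "f v = (of_real p * iexp (\<theta> * (v - a)) + of_real (1 - p)) * \<phi> (\<theta> * (x - v))" for v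
  define g where "g v = (of_real q * iexp (\<theta> * (b - v)) + of_real (1 - q)) * \<psi> (\<theta> * (v - x))" for v
  have [measurable]: "f \<in> borel_measurable borel" "g \<in> borel_measurable borel"
    unfolding f_def g_def by measurable
  have "cmod (f v) \<le> 1" "cmod (g v) \<le> 1" for v
    using cmod_convex_iexp_le[of p "\<theta> * (v - a)" 0] cmod_convex_iexp_le[of q "\<theta> * (b - v)" 0] p q
      le1[of "\<theta> * (x - v)"] le1[of "\<theta> * (v - x)"]
    by (auto simp: f_def g_def norm_mult mult_le_one simp del: of_real_diff)
  then have int: "integrable leb_unit (\<lambda>v. indicator {a<..x} v *\<^sub>R f v)"
      "integrable leb_unit (\<lambda>v. indicator {x<..b} v *\<^sub>R g v)"
    by (auto intro!: L.integrable_const_bound[where B=1] simp: indicator_def)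
  have int1: "integrable leb_unit (\<lambda>v. indicator {c<..d} v *\<^sub>R (1::complex))" for c d
    by (auto intro!: L.integrable_const_bound[where B=1] simp: indicator_def)
  have len: "(\<integral>v. indicator {c<..d} v *\<^sub>R (1::complex) \<partial>leb_unit) = of_real (d - c)"
    if "0 \<le> c" "c \<le> d" "d \<le> 1" for c d
    using that by (subst integral_leb_unit_Ioc) (auto simp: scaleR_conv_of_real)
  have lin: "(\<integral>v. c1 * f1 v + c2 * f2 v + c3 * (1 - i1 v - i2 v) \<partial>leb_unit)
      = c1 * integral\<^sup>L leb_unit f1 + c2 * integral\<^sup>L leb_unit f2
        + c3 * (1 - integral\<^sup>L leb_unit i1 - integral\<^sup>L leb_unit i2)"
    if "integrable leb_unit f1" "integrable leb_unit f2" "integrable leb_unit i1" "integrable leb_unit i2"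
    for c1 c2 c3 :: complex and f1 f2 i1 i2
    using that by (simp add: L.prob_space[simplified])
  have "split_step \<theta> p x (beta_mix_char \<theta> p x) a b v
      = \<psi> (\<theta> * (b - x)) * (indicator {a<..x} v *\<^sub>R f v) + \<phi> (\<theta> * (x - a)) * (indicator {x<..b} v *\<^sub>R g v)
        + beta_mix_char \<theta> p x a b * (1 - indicator {a<..x} v *\<^sub>R 1 - indicator {x<..b} v *\<^sub>R 1)" for v
    by (auto simp: split_step_def mix f_def g_def q_def indicator_def)
  then have "(\<integral>v. split_step \<theta> p x (beta_mix_char \<theta> p x) a b v \<partial>leb_unit)
      = \<psi> (\<theta> * (b - x)) * (\<integral>v. indicator {a<..x} v *\<^sub>R f v \<partial>leb_unit)
        + \<phi> (\<theta> * (x - a)) * (\<integral>v. indicator {x<..b} v *\<^sub>R g v \<partial>leb_unit)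
        + beta_mix_char \<theta> p x a b * (1 - of_real (x - a) - of_real (b - x))"
    using len[of a x] len[of x b] ab by (simp only: lin[OF int int1 int1])
  also have "(\<integral>v. indicator {a<..x} v *\<^sub>R f v \<partial>leb_unit) = of_real (x - a) * \<phi> (\<theta> * (x - a))"
    using ab char_beta_renewal_left[OF p, of a x \<theta>]
    by (subst integral_leb_unit_Ioc) (auto simp: f_def \<phi>_def simp del: of_real_diff)
  also have "(\<integral>v. indicator {x<..b} v *\<^sub>R g v \<partial>leb_unit) = of_real (b - x) * \<psi> (\<theta> * (b - x))"
    using ab char_beta_renewal_right[OF q(1,2), of x b \<theta>]
    by (subst integral_leb_unit_Ioc) (auto simp: g_def \<psi>_def simp del: of_real_diff)
  also have "\<psi> (\<theta> * (b - x)) * (of_real (x - a) * \<phi> (\<theta> * (x - a)))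
        + \<phi> (\<theta> * (x - a)) * (of_real (b - x) * \<psi> (\<theta> * (b - x)))
        + beta_mix_char \<theta> p x a b * (1 - of_real (x - a) - of_real (b - x)) = beta_mix_char \<theta> p x a b"
    by (simp add: mix algebra_simps)
  finally show ?thesis ..
qed

lemma cmod_char_beta_minus_1:
  assumes "0 < p" "p < 1"
  shows "cmod (char (beta_distribution p (1 - p)) t - 1) \<le> \<bar>t\<bar>"
proof -
  interpret real_distribution "beta_distribution p (1 - p)" using assms by (rule real_distribution_beta)
  show ?thesis
    unfolding char_def
  proof (rule norm_integral_minus_1_le)
    show "AE x in beta_distribution p (1 - p). cmod (iexp (t * x) - 1) \<le> \<bar>t\<bar>"
    proof (rule eventually_mono[OF AE_beta_distribution])
      fix x :: real assume "0 < x \<and> x < 1"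
      then have "\<bar>t * x\<bar> \<le> \<bar>t\<bar>" by (simp add: abs_mult mult_left_le)
      then show "cmod (iexp (t * x) - 1) \<le> \<bar>t\<bar>"
        using cmod_iexp_minus_1[of "t * x"] by linarith
    qed
  qed (auto intro!: integrable_const_bound[where B=1])
qed

section \<open>The random solution of the splitting equation\<close>

abbreviation uniform_sequence :: "(nat \<Rightarrow> real) measure" where
  "uniform_sequence \<equiv> \<Pi>\<^sub>M j\<in>UNIV. leb_unit"

abbreviation sign_sequence :: "real \<Rightarrow> (nat \<Rightarrow> bool) measure" where
  "sign_sequence p \<equiv> \<Pi>\<^sub>M j\<in>UNIV. measure_pmf (bernoulli_pmf p)"

lemma sets_uniform_sequence: "sets uniform_sequence = sets (\<Pi>\<^sub>M j\<in>UNIV. borel)"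
  by (intro sets_PiM_cong) auto

lemma sets_sign_sequence: "sets (sign_sequence p) = sets (\<Pi>\<^sub>M j\<in>UNIV. count_space UNIV)"
  by (intro sets_PiM_cong) auto

lemma prob_space_uniform_sequence: "prob_space uniform_sequence"
  by (intro prob_space_PiM prob_space_leb_unit)

lemma prob_space_sign_sequence: "prob_space (sign_sequence p)"
  by (intro prob_space_PiM prob_space_measure_pmf)

lemma measurable_prec_mass_sequence [measurable (raw)]:
  assumes f: "f \<in> N \<rightarrow>\<^sub>M uniform_sequence" and t: "t \<in> N \<rightarrow>\<^sub>M sign_sequence p"
    and "c \<in> borel_measurable N" "a \<in> borel_measurable N" "b \<in> borel_measurable N"
  shows "(\<lambda>\<omega>. prec_mass (f \<omega>) (t \<omega>) (c \<omega>) (a \<omega>) (b \<omega>)) \<in> borel_measurable N"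
  using assms
  by (intro measurable_prec_mass)
     (simp_all only: measurable_cong_sets[OF refl sets_uniform_sequence] measurable_cong_sets[OF refl sets_sign_sequence])

text \<open>The shift invariance that makes the recursion useful: putting an independent variable in front
  of an i.i.d. sequence with the same marginal law does not change the law of the sequence.\<close>
lemma integral_iid_sequence:
  fixes f :: "(nat \<Rightarrow> 'a) \<Rightarrow> complex" and D :: "'a measure"
  assumes "prob_space D" and [measurable]: "f \<in> borel_measurable (\<Pi>\<^sub>M i\<in>UNIV. D)"
    and B: "\<And>\<omega>. norm (f \<omega>) \<le> B"
  shows "(\<integral>\<omega>. f \<omega> \<partial>(\<Pi>\<^sub>M i\<in>UNIV. D)) = (\<integral>v. \<integral>\<omega>. f (case_nat v \<omega>) \<partial>(\<Pi>\<^sub>M i\<in>UNIV. D) \<partial>D)"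
proof -
  interpret D: prob_space D by fact
  interpret sequence_space D ..
  interpret P: prob_space S by (rule prob_space_PiM) (rule assms(1))
  interpret DS: pair_prob_space D S ..
  have "(\<integral>\<omega>. f \<omega> \<partial>S) = (\<integral>z. f ((\<lambda>(v, \<omega>). case_nat v \<omega>) z) \<partial>(D \<Otimes>\<^sub>M S))"
    by (subst PiM_iter[symmetric], subst integral_distr) auto
  also have "\<dots> = (\<integral>v. \<integral>\<omega>. f (case_nat v \<omega>) \<partial>S \<partial>D)"
    by (subst DS.integral_fst'[symmetric]) (auto intro!: DS.integrable_const_bound[where B=B] B)
  finally show ?thesis .
qed

definition prec_mass_char :: "real \<Rightarrow> real \<Rightarrow> real \<Rightarrow> real \<Rightarrow> real \<Rightarrow> complex" where
  "prec_mass_char \<theta> p x a b =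
    (\<integral>u. \<integral>s. iexp (\<theta> * prec_mass u s x a b) \<partial>sign_sequence p \<partial>uniform_sequence)"

lemma measurable_prec_mass_char:
  assumes [measurable]: "a \<in> borel_measurable N" "b \<in> borel_measurable N"
  shows "(\<lambda>\<omega>. prec_mass_char \<theta> p x (a \<omega>) (b \<omega>)) \<in> borel_measurable N"
proof -
  interpret U: prob_space uniform_sequence by (rule prob_space_uniform_sequence)
  interpret S: prob_space "sign_sequence p" by (rule prob_space_sign_sequence)
  show ?thesis unfolding prec_mass_char_def by measurable
qed

lemma cmod_prec_mass_char_le_1: "cmod (prec_mass_char \<theta> p x a b) \<le> 1"
proof -
  interpret U: prob_space uniform_sequence by (rule prob_space_uniform_sequence)
  interpret S: prob_space "sign_sequence p" by (rule prob_space_sign_sequence)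
  show ?thesis unfolding prec_mass_char_def
    by (intro U.norm_integral_le S.norm_integral_le AE_I2) auto
qed

text \<open>Conditioning on the first point and the first sign turns the recursion for \<open>prec_mass\<close> into the
  splitting equation: the block decided by the sign contributes a factor that does not depend on
  the shifted sequences.\<close>
lemma prec_mass_char_fixed_point:
  assumes p: "0 \<le> p" "p \<le> 1" and ab: "a \<le> x" "x \<le> b"
  shows "prec_mass_char \<theta> p x a b = (\<integral>v. split_step \<theta> p x (prec_mass_char \<theta> p x) a b v \<partial>leb_unit)"
proof -
  interpret U: prob_space uniform_sequence by (rule prob_space_uniform_sequence)
  interpret S: prob_space "sign_sequence p" by (rule prob_space_sign_sequence)
  define F where "F u s = iexp (\<theta> * prec_mass u s x a b)" for u s
  define H where "H u = (\<integral>s. F u s \<partial>sign_sequence p)" for u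
  have [measurable]: "(\<lambda>s. F u s) \<in> borel_measurable (sign_sequence p)" for u
  proof -
    have "(\<lambda>_. u) \<in> sign_sequence p \<rightarrow>\<^sub>M uniform_sequence"
      by (auto simp: space_PiM)
    then show ?thesis unfolding F_def by measurable
  qed
  have [measurable]: "H \<in> borel_measurable uniform_sequence"
    unfolding H_def F_def by measurable
  have F_bound: "cmod (F u s) \<le> 1" for u s by (simp add: F_def)
  have H_bound: "cmod (H u) \<le> 1" for u
    unfolding H_def by (intro S.norm_integral_le AE_I2 F_bound) simp
  have H: "H u = of_real p * (\<integral>s. F u (case_nat True s) \<partial>sign_sequence p)
         + of_real (1 - p) * (\<integral>s. F u (case_nat False s) \<partial>sign_sequence p)" for u
    unfolding H_def using p
    by (subst integral_iid_sequence[OF prob_space_measure_pmf _ F_bound])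
       (simp_all add: integral_measure_pmf[of UNIV] UNIV_bool scaleR_conv_of_real)
  have "prec_mass_char \<theta> p x a b = (\<integral>u. H u \<partial>uniform_sequence)"
    by (simp add: prec_mass_char_def H_def F_def)
  also have "\<dots> = (\<integral>v. \<integral>u. H (case_nat v u) \<partial>uniform_sequence \<partial>leb_unit)"
    by (rule integral_iid_sequence[OF prob_space_leb_unit _ H_bound]) measurable
  also have "(\<lambda>v. \<integral>u. H (case_nat v u) \<partial>uniform_sequence) = split_step \<theta> p x (prec_mass_char \<theta> p x) a b"
  proof
    fix v
    have factor: "(\<integral>u. of_real p * (\<integral>s. iexp (\<theta> * (c + prec_mass u s x a' b')) \<partial>sign_sequence p)
         + of_real (1 - p) * (\<integral>s. iexp (\<theta> * (d + prec_mass u s x a' b')) \<partial>sign_sequence p) \<partial>uniform_sequence)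
       = (of_real p * iexp (\<theta> * c) + of_real (1 - p) * iexp (\<theta> * d)) * prec_mass_char \<theta> p x a' b'"
      for a' b' c d
    proof -
      have "iexp (\<theta> * (c + z)) = iexp (\<theta> * c) * iexp (\<theta> * z)" for c z
        by (simp add: distrib_left exp_add)
      then show ?thesis
        unfolding prec_mass_char_def
        by (simp only: integral_mult_right_zero mult.assoc[symmetric] distrib_right[symmetric])
    qed
    show "(\<integral>u. H (case_nat v u) \<partial>uniform_sequence) = split_step \<theta> p x (prec_mass_char \<theta> p x) a b v"
      unfolding H unfolding F_def prec_mass_case_nat[OF ab]
      using factor[of "v - a" v b 0] factor[of 0 a v "b - v"] factor[of 0 a b 0]
      by (simp add: split_step_def del: greaterThanAtMost_iff)
  qed
  finally show ?thesis .
qed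

lemma cmod_prec_mass_char_minus_1:
  assumes "a \<le> b"
  shows "cmod (prec_mass_char \<theta> p x a b - 1) \<le> \<bar>\<theta>\<bar> * (b - a)"
proof -
  interpret U: prob_space uniform_sequence by (rule prob_space_uniform_sequence)
  interpret S: prob_space "sign_sequence p" by (rule prob_space_sign_sequence)
  define H where "H u = (\<integral>s. iexp (\<theta> * prec_mass u s x a b) \<partial>sign_sequence p)" for u
  have [measurable]: "H \<in> borel_measurable uniform_sequence"
    unfolding H_def by measurable
  have H_bound: "cmod (H u) \<le> 1" for u
    unfolding H_def by (intro S.norm_integral_le AE_I2) auto
  have F: "cmod (iexp (\<theta> * prec_mass u s x a b) - 1) \<le> \<bar>\<theta>\<bar> * (b - a)" for u s
    using cmod_iexp_minus_1[of "\<theta> * prec_mass u s x a b"]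
      mult_left_mono[OF prec_mass_le[OF assms, of u s x] abs_ge_zero[of \<theta>]]
      prec_mass_nonneg[of u s x a b]
    by (simp add: abs_mult)
  have "cmod (H u - 1) \<le> \<bar>\<theta>\<bar> * (b - a)" for u
  proof -
    have [measurable]: "(\<lambda>_. u) \<in> sign_sequence p \<rightarrow>\<^sub>M uniform_sequence"
      by (auto simp: space_PiM)
    show ?thesis unfolding H_def using assms F
      by (intro S.norm_integral_minus_1_le S.integrable_const_bound[where B=1]) auto
  qed
  then have "cmod ((\<integral>u. H u \<partial>uniform_sequence) - 1) \<le> \<bar>\<theta>\<bar> * (b - a)"
    using assms H_bound
    by (intro U.norm_integral_minus_1_le U.integrable_const_bound[where B=1]) auto
  then show ?thesis by (simp add: prec_mass_char_def H_def)
qed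

text \<open>Both solutions differ from \<open>1\<close> by at most \<open>\<bar>\<theta>\<bar> (b - a)\<close>, because the two masses are
  bounded by \<open>b - a\<close>; so the uniqueness result applies with \<open>C = 2 \<bar>\<theta>\<bar>\<close>.\<close>
lemma prec_mass_char_eq:
  assumes p: "0 < p" "p < 1" and ab: "0 \<le> a" "a \<le> x" "x \<le> b" "b \<le> 1"
  shows "prec_mass_char \<theta> p x a b = beta_mix_char \<theta> p x a b"
proof (rule split_step_fixed_point_unique[where \<theta>=\<theta> and p=p and x=x and C="2 * \<bar>\<theta>\<bar>"])
  interpret P: real_distribution "beta_distribution p (1 - p)" using p by (rule real_distribution_beta)
  interpret Q: real_distribution "beta_distribution (1 - p) p"
    using real_distribution_beta[of "1 - p"] p by simp
  show "integrable leb_unit (split_step \<theta> p x (prec_mass_char \<theta> p x) a b)" for a b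
    using p by (intro integrable_split_step cmod_prec_mass_char_le_1 measurable_prec_mass_char) auto
  show "integrable leb_unit (split_step \<theta> p x (beta_mix_char \<theta> p x) a b)" for a b
    using p unfolding beta_mix_char_def
    by (intro integrable_split_step)
       (auto simp: norm_mult intro!: mult_le_one P.cmod_char_le_1 Q.cmod_char_le_1)
  fix a b :: real assume ab: "0 \<le> a" "a \<le> x" "x \<le> b" "b \<le> 1"
  show "prec_mass_char \<theta> p x a b = (\<integral>v. split_step \<theta> p x (prec_mass_char \<theta> p x) a b v \<partial>leb_unit)"
    using p ab by (intro prec_mass_char_fixed_point) auto
  show "beta_mix_char \<theta> p x a b = (\<integral>v. split_step \<theta> p x (beta_mix_char \<theta> p x) a b v \<partial>leb_unit)"
    by (rule beta_mix_char_fixed_point[OF p ab])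
  define A B where "A = char (beta_distribution p (1 - p)) (\<theta> * (x - a))"
    and "B = char (beta_distribution (1 - p) p) (\<theta> * (b - x))"
  have "cmod (A - 1) \<le> \<bar>\<theta>\<bar> * (x - a)" "cmod (B - 1) \<le> \<bar>\<theta>\<bar> * (b - x)"
    using cmod_char_beta_minus_1[OF p, of "\<theta> * (x - a)"] cmod_char_beta_minus_1[of "1 - p" "\<theta> * (b - x)"] p ab
    by (auto simp: A_def B_def abs_mult)
  moreover have "cmod (A * B - 1) \<le> cmod (A - 1) + cmod (B - 1)"
  proof -
    have "A * B - 1 = (A - 1) * B + (B - 1)" by (simp add: algebra_simps)
    also have "cmod \<dots> \<le> cmod (A - 1) * cmod B + cmod (B - 1)"
      by (rule order_trans[OF norm_triangle_ineq]) (simp add: norm_mult)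
    also have "\<dots> \<le> cmod (A - 1) + cmod (B - 1)"
      using Q.cmod_char_le_1 by (simp add: B_def mult_left_le)
    finally show ?thesis .
  qed
  ultimately have "cmod (beta_mix_char \<theta> p x a b - 1) \<le> \<bar>\<theta>\<bar> * (b - a)"
    by (simp add: beta_mix_char_def A_def B_def algebra_simps)
  moreover have "cmod (prec_mass_char \<theta> p x a b - 1) \<le> \<bar>\<theta>\<bar> * (b - a)"
    using ab by (intro cmod_prec_mass_char_minus_1) auto
  moreover have "cmod (prec_mass_char \<theta> p x a b - beta_mix_char \<theta> p x a b)
      \<le> cmod (prec_mass_char \<theta> p x a b - 1) + cmod (beta_mix_char \<theta> p x a b - 1)"
    using norm_triangle_ineq4[of "prec_mass_char \<theta> p x a b - 1" "beta_mix_char \<theta> p x a b - 1"] by simp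
  ultimately show "cmod (prec_mass_char \<theta> p x a b - beta_mix_char \<theta> p x a b) \<le> 2 * \<bar>\<theta>\<bar> * (b - a)"
    by linarith
qed (use p ab in auto)

text \<open>The splitting equation on the whole of \<open>[0,1)\<close> identifies the characteristic function, and
  with it the law, of \<open>\<phi>(x)\<close>.\<close>
lemma distr_rec_phi:
  assumes p: "0 < p" "p < 1" and x: "0 \<le> x" "x \<le> 1"
  shows "distr (uniform_sequence \<Otimes>\<^sub>M sign_sequence p) borel (\<lambda>(u, s). rec_phi u s x)
    = distr (beta_distribution p (1 - p) \<Otimes>\<^sub>M beta_distribution (1 - p) p) borel
        (\<lambda>(y, z). x * y + (1 - x) * z)" (is "?L = ?R")
proof (rule Levy_uniqueness)
  interpret U: prob_space uniform_sequence by (rule prob_space_uniform_sequence)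
  interpret S: prob_space "sign_sequence p" by (rule prob_space_sign_sequence)
  interpret P: real_distribution "beta_distribution p (1 - p)" using p by (rule real_distribution_beta)
  interpret Q: real_distribution "beta_distribution (1 - p) p"
    using real_distribution_beta[of "1 - p"] p by simp
  interpret US: pair_prob_space uniform_sequence "sign_sequence p" ..
  interpret PQ: pair_prob_space "beta_distribution p (1 - p)" "beta_distribution (1 - p) p" ..
  have [measurable]: "(\<lambda>(u, s). rec_phi u s x) \<in> borel_measurable (uniform_sequence \<Otimes>\<^sub>M sign_sequence p)"
    unfolding rec_phi_eq_prec_mass by measurable
  show "real_distribution ?L" "real_distribution ?R"
    by (auto intro!: US.real_distribution_distr PQ.real_distribution_distr)
  show "char ?L = char ?R"
  proof
    fix t
    have "char ?L t = (\<integral>z. iexp (t * (case z of (u, s) \<Rightarrow> rec_phi u s x)) \<partial>(uniform_sequence \<Otimes>\<^sub>M sign_sequence p))"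
      unfolding char_def by (subst integral_distr) auto
    also have "\<dots> = prec_mass_char t p x 0 1"
      unfolding prec_mass_char_def rec_phi_eq_prec_mass
      by (subst US.integral_fst'[symmetric])
         (auto intro!: US.integrable_const_bound[where B=1])
    also have "\<dots> = beta_mix_char t p x 0 1"
      using x by (intro prec_mass_char_eq[OF p]) auto
    also have "\<dots> = (\<integral>y. \<integral>z. iexp (t * x * y) * iexp (t * (1 - x) * z)
        \<partial>beta_distribution (1 - p) p \<partial>beta_distribution p (1 - p))"
      by (simp add: beta_mix_char_def char_def)
    also have "\<dots> = (\<integral>w. iexp (t * x * fst w) * iexp (t * (1 - x) * snd w)
        \<partial>(beta_distribution p (1 - p) \<Otimes>\<^sub>M beta_distribution (1 - p) p))"
      by (subst PQ.integral_fst'[symmetric])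
         (auto intro!: PQ.integrable_const_bound[where B=1] simp: norm_mult)
    also have "\<dots> = (\<integral>w. iexp (t * (case w of (y, z) \<Rightarrow> x * y + (1 - x) * z))
        \<partial>(beta_distribution p (1 - p) \<Otimes>\<^sub>M beta_distribution (1 - p) p))"
      by (rule Bochner_Integration.integral_cong) (auto simp: algebra_simps simp flip: exp_add)
    also have "\<dots> = char ?R t"
      unfolding char_def by (subst integral_distr) auto
    finally show "char ?L t = char ?R t" .
  qed
qed

section \<open>Joint laws of independent variables\<close>

lemma distr_bool_eq_bernoulli:
  assumes "prob_space M" and X: "X \<in> M \<rightarrow>\<^sub>M count_space UNIV"
    and p: "measure M {\<omega> \<in> space M. X \<omega>} = p"
  shows "distr M (count_space UNIV) X = measure_pmf (bernoulli_pmf p)"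
proof -
  interpret prob_space M by fact
  have p01: "0 \<le> p" "p \<le> 1" using p by (auto simp: prob_le_1)
  have ev: "{\<omega> \<in> space M. X \<omega>} \<in> sets M" using X by measurable
  have "measure M {\<omega> \<in> space M. \<not> X \<omega>} = 1 - p"
    using prob_neg[OF ev] p by simp
  moreover have "X -` {True} \<inter> space M = {\<omega> \<in> space M. X \<omega>}"
    "X -` {False} \<inter> space M = {\<omega> \<in> space M. \<not> X \<omega>}" by auto
  ultimately have "emeasure (distr M (count_space UNIV) X) {b} = emeasure (measure_pmf (bernoulli_pmf p)) {b}" for b
    using p p01 by (cases b) (simp_all add: emeasure_distr[OF X] emeasure_pmf_single emeasure_eq_measure)
  then show ?thesis
    by (intro measure_eqI_countable[of _ UNIV]) auto
qed

text \<open>Random variables with values in two different types, as a sequence of reals and a sequence of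
  signs, cannot be the arguments of \<open>indep_var\<close>; hence independence is expressed by the product
  rule for preimages.\<close>
lemma (in prob_space) distr_pair_eq_pair_measure:
  assumes X [measurable]: "X \<in> M \<rightarrow>\<^sub>M S" and Y [measurable]: "Y \<in> M \<rightarrow>\<^sub>M T"
    and ind: "\<And>A B. A \<in> sets S \<Longrightarrow> B \<in> sets T \<Longrightarrow>
      prob ((X -` A \<inter> space M) \<inter> (Y -` B \<inter> space M)) = prob (X -` A \<inter> space M) * prob (Y -` B \<inter> space M)"
  shows "distr M (S \<Otimes>\<^sub>M T) (\<lambda>\<omega>. (X \<omega>, Y \<omega>)) = distr M S X \<Otimes>\<^sub>M distr M T Y"
proof -
  interpret X: prob_space "distr M S X" by (rule prob_space_distr) fact
  interpret Y: prob_space "distr M T Y" by (rule prob_space_distr) fact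
  have "distr M S X \<Otimes>\<^sub>M distr M T Y = distr M (S \<Otimes>\<^sub>M T) (\<lambda>\<omega>. (X \<omega>, Y \<omega>))"
  proof (rule pair_measure_eqI)
    fix A B assume "A \<in> sets (distr M S X)" "B \<in> sets (distr M T Y)"
    then have [measurable]: "A \<in> sets S" "B \<in> sets T" by auto
    have "(\<lambda>\<omega>. (X \<omega>, Y \<omega>)) -` (A \<times> B) \<inter> space M = (X -` A \<inter> space M) \<inter> (Y -` B \<inter> space M)" by auto
    then show "emeasure (distr M S X) A * emeasure (distr M T Y) B
        = emeasure (distr M (S \<Otimes>\<^sub>M T) (\<lambda>\<omega>. (X \<omega>, Y \<omega>))) (A \<times> B)"
      by (simp add: emeasure_distr emeasure_eq_measure ind ennreal_mult)
  qed (auto intro: X.sigma_finite_measure_axioms Y.sigma_finite_measure_axioms)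
  then show ?thesis ..
qed

lemma (in prob_space) distr_pair_compose_indep_var:
  assumes ind: "indep_var P X Q Y" and f: "f \<in> P \<rightarrow>\<^sub>M S" and g: "g \<in> Q \<rightarrow>\<^sub>M T"
  shows "distr M (S \<Otimes>\<^sub>M T) (\<lambda>\<omega>. (f (X \<omega>), g (Y \<omega>))) = distr M S (\<lambda>\<omega>. f (X \<omega>)) \<Otimes>\<^sub>M distr M T (\<lambda>\<omega>. g (Y \<omega>))"
proof (rule distr_pair_eq_pair_measure)
  have X: "X \<in> M \<rightarrow>\<^sub>M P" and Y: "Y \<in> M \<rightarrow>\<^sub>M Q"
    using ind by (auto dest: indep_var_rv1 indep_var_rv2)
  show "(\<lambda>\<omega>. f (X \<omega>)) \<in> M \<rightarrow>\<^sub>M S" "(\<lambda>\<omega>. g (Y \<omega>)) \<in> M \<rightarrow>\<^sub>M T"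
    using measurable_compose[OF X f] measurable_compose[OF Y g] by auto
  fix A B assume "A \<in> sets S" "B \<in> sets T"
  then have "f -` A \<inter> space P \<in> sets P" "g -` B \<inter> space Q \<in> sets Q"
    using f g by auto
  from indep_varD[OF ind this]
  have *: "prob ((\<lambda>x. (X x, Y x)) -` ((f -` A \<inter> space P) \<times> (g -` B \<inter> space Q)) \<inter> space M)
      = prob (X -` (f -` A \<inter> space P) \<inter> space M) * prob (Y -` (g -` B \<inter> space Q) \<inter> space M)" .
  have "X -` (f -` A \<inter> space P) \<inter> space M = (\<lambda>\<omega>. f (X \<omega>)) -` A \<inter> space M"
    "Y -` (g -` B \<inter> space Q) \<inter> space M = (\<lambda>\<omega>. g (Y \<omega>)) -` B \<inter> space M"
    "(\<lambda>x. (X x, Y x)) -` ((f -` A \<inter> space P) \<times> (g -` B \<inter> space Q)) \<inter> space M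
      = ((\<lambda>\<omega>. f (X \<omega>)) -` A \<inter> space M) \<inter> ((\<lambda>\<omega>. g (Y \<omega>)) -` B \<inter> space M)"
    using measurable_space[OF X] measurable_space[OF Y] by auto
  with * show "prob (((\<lambda>\<omega>. f (X \<omega>)) -` A \<inter> space M) \<inter> ((\<lambda>\<omega>. g (Y \<omega>)) -` B \<inter> space M))
      = prob ((\<lambda>\<omega>. f (X \<omega>)) -` A \<inter> space M) * prob ((\<lambda>\<omega>. g (Y \<omega>)) -` B \<inter> space M)"
    by simp
qed

lemma distr_uniform_sign_sequence:
  assumes "prob_space M"
    and U: "prob_space.indep_vars M (\<lambda>_. borel) U UNIV" "\<And>j. distr M borel (U j) = leb_unit"
    and S: "prob_space.indep_vars M (\<lambda>_. count_space UNIV) S UNIV"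
      "\<And>j. measure M {\<omega> \<in> space M. S j \<omega>} = p"
    and US: "prob_space.indep_set M
           {(\<lambda>\<omega> j. U j \<omega>) -` A \<inter> space M | A. A \<in> sets (\<Pi>\<^sub>M j\<in>UNIV. borel)}
           {(\<lambda>\<omega> j. S j \<omega>) -` B \<inter> space M | B. B \<in> sets (\<Pi>\<^sub>M j\<in>UNIV. count_space UNIV)}"
  shows "(\<lambda>\<omega>. (\<lambda>j. U j \<omega>, \<lambda>j. S j \<omega>)) \<in> M \<rightarrow>\<^sub>M uniform_sequence \<Otimes>\<^sub>M sign_sequence p" (is ?meas)
    and "distr M (uniform_sequence \<Otimes>\<^sub>M sign_sequence p) (\<lambda>\<omega>. (\<lambda>j. U j \<omega>, \<lambda>j. S j \<omega>))
      = uniform_sequence \<Otimes>\<^sub>M sign_sequence p" (is ?distr)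
proof -
  interpret prob_space M by fact
  let ?PU = "\<Pi>\<^sub>M j\<in>UNIV. borel :: real measure"
  let ?PS = "\<Pi>\<^sub>M j\<in>UNIV. count_space UNIV :: bool measure"
  have rvU: "U j \<in> borel_measurable M" and rvS: "S j \<in> M \<rightarrow>\<^sub>M count_space UNIV" for j
    using U(1) S(1) by (auto simp: indep_vars_def)
  have mU: "(\<lambda>\<omega> j. U j \<omega>) \<in> M \<rightarrow>\<^sub>M ?PU" and mS: "(\<lambda>\<omega> j. S j \<omega>) \<in> M \<rightarrow>\<^sub>M ?PS"
    using measurable_restrict[of UNIV U M "\<lambda>_. borel"] measurable_restrict[of UNIV S M "\<lambda>_. count_space UNIV"] rvU rvS
    by (auto simp: restrict_UNIV)
  have dU: "distr M ?PU (\<lambda>\<omega> j. U j \<omega>) = uniform_sequence"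
    using indep_vars_iff_distr_eq_PiM'[of UNIV U "\<lambda>_. borel"] U rvU by (simp add: restrict_UNIV)
  have dS: "distr M ?PS (\<lambda>\<omega> j. S j \<omega>) = sign_sequence p"
    using indep_vars_iff_distr_eq_PiM'[of UNIV S "\<lambda>_. count_space UNIV"] S(1) rvS
      distr_bool_eq_bernoulli[OF prob_space_axioms rvS S(2)] by (simp add: restrict_UNIV)
  have "distr M (?PU \<Otimes>\<^sub>M ?PS) (\<lambda>\<omega>. (\<lambda>j. U j \<omega>, \<lambda>j. S j \<omega>)) = distr M ?PU (\<lambda>\<omega> j. U j \<omega>) \<Otimes>\<^sub>M distr M ?PS (\<lambda>\<omega> j. S j \<omega>)"
    by (intro distr_pair_eq_pair_measure mU mS indep_setD[OF US]) blast+
  then have "uniform_sequence \<Otimes>\<^sub>M sign_sequence p = distr M (?PU \<Otimes>\<^sub>M ?PS) (\<lambda>\<omega>. (\<lambda>j. U j \<omega>, \<lambda>j. S j \<omega>))"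
    unfolding dU dS ..
  also have "\<dots> = distr M (uniform_sequence \<Otimes>\<^sub>M sign_sequence p) (\<lambda>\<omega>. (\<lambda>j. U j \<omega>, \<lambda>j. S j \<omega>))"
    by (intro distr_cong sets_pair_measure_cong sets_uniform_sequence[symmetric] sets_sign_sequence[symmetric]) auto
  finally show ?distr ..
  show ?meas
    using measurable_Pair[OF mU mS]
      measurable_cong_sets[OF refl sets_pair_measure_cong[OF sets_uniform_sequence sets_sign_sequence]] by blast
qed

lemma (in prob_space) distr_triple_indep:
  fixes V X X' :: "'a \<Rightarrow> real"
  assumes ind: "indep_vars (\<lambda>_. borel) (\<lambda>i. [V, X, X'] ! i) {..<3}"
  shows "V \<in> borel_measurable M" "X \<in> borel_measurable M" "X' \<in> borel_measurable M"
    and "distr M (borel \<Otimes>\<^sub>M (borel \<Otimes>\<^sub>M borel)) (\<lambda>\<omega>. (V \<omega>, X \<omega>, X' \<omega>))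
      = distr M borel V \<Otimes>\<^sub>M (distr M borel X \<Otimes>\<^sub>M distr M borel X')"
proof -
  let ?Y = "\<lambda>i. [V, X, X'] ! i"
  have rv: "?Y i \<in> borel_measurable M" if "i < 3" for i
    using ind that by (auto simp: indep_vars_def)
  from rv[of 0] rv[of 1] rv[of 2]
  show "V \<in> borel_measurable M" "X \<in> borel_measurable M" "X' \<in> borel_measurable M"
    by (simp_all add: numeral_2_eq_2)
  have "distr M (borel \<Otimes>\<^sub>M borel) (\<lambda>\<omega>. (restrict (\<lambda>i. ?Y i \<omega>) {1} 1, restrict (\<lambda>i. ?Y i \<omega>) {2} 2))
      = distr M borel (\<lambda>\<omega>. restrict (\<lambda>i. ?Y i \<omega>) {1} 1) \<Otimes>\<^sub>M distr M borel (\<lambda>\<omega>. restrict (\<lambda>i. ?Y i \<omega>) {2} 2)"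
    by (rule distr_pair_compose_indep_var[OF indep_var_restrict[OF ind]]) auto
  then have XX': "distr M (borel \<Otimes>\<^sub>M borel) (\<lambda>\<omega>. (X \<omega>, X' \<omega>)) = distr M borel X \<Otimes>\<^sub>M distr M borel X'"
    by (simp add: numeral_2_eq_2)
  have "distr M (borel \<Otimes>\<^sub>M (borel \<Otimes>\<^sub>M borel)) (\<lambda>\<omega>. (restrict (\<lambda>i. ?Y i \<omega>) {0} 0,
        (\<lambda>f. (f 1, f 2)) (restrict (\<lambda>i. ?Y i \<omega>) {1, 2})))
      = distr M borel (\<lambda>\<omega>. restrict (\<lambda>i. ?Y i \<omega>) {0} 0) \<Otimes>\<^sub>M
        distr M (borel \<Otimes>\<^sub>M borel) (\<lambda>\<omega>. (\<lambda>f. (f 1, f 2)) (restrict (\<lambda>i. ?Y i \<omega>) {1, 2}))"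
    by (rule distr_pair_compose_indep_var[OF indep_var_restrict[OF ind]]) auto
  then show "distr M (borel \<Otimes>\<^sub>M (borel \<Otimes>\<^sub>M borel)) (\<lambda>\<omega>. (V \<omega>, X \<omega>, X' \<omega>))
      = distr M borel V \<Otimes>\<^sub>M (distr M borel X \<Otimes>\<^sub>M distr M borel X')"
    unfolding XX'[symmetric] by (simp add: numeral_2_eq_2)
qed

section \<open>The intensity measure\<close>

lemma measurable_rec_phi [measurable (raw)]:
  assumes "f \<in> N \<rightarrow>\<^sub>M uniform_sequence" "t \<in> N \<rightarrow>\<^sub>M sign_sequence p" "c \<in> borel_measurable N"
  shows "(\<lambda>\<omega>. rec_phi (f \<omega>) (t \<omega>) (c \<omega>)) \<in> borel_measurable N"
  unfolding rec_phi_eq_prec_mass using assms by measurable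

lemma emeasure_rec_separable_permuton:
  assumes [measurable]: "A \<in> sets borel"
  shows "emeasure (rec_separable_permuton u s) A = (\<integral>\<^sup>+x. indicator A (x, rec_phi u s x) \<partial>leb_unit)"
proof -
  have [measurable]: "rec_phi u s \<in> borel_measurable borel"
    unfolding rec_phi_eq_prec_mass by (rule measurable_prec_mass) (auto simp: space_PiM)
  have "emeasure (rec_separable_permuton u s) A = (\<integral>\<^sup>+z. indicator A z \<partial>rec_separable_permuton u s)"
    by (subst nn_integral_indicator) (auto simp: rec_separable_permuton_def)
  also have "\<dots> = (\<integral>\<^sup>+x. indicator A (x, rec_phi u s x) \<partial>leb_unit)"
    unfolding rec_separable_permuton_def by (subst nn_integral_distr) auto
  finally show ?thesis .
qed

text \<open>Fubini's theorem reduces the identity to the law of \<open>\<phi>(x)\<close> for each fixed \<open>x\<close> in \<open>[0,1]\<close>.\<close>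
lemma nn_integral_rec_separable_permuton:
  assumes p: "0 < p" "p < 1" and [measurable]: "A \<in> sets borel"
  shows "(\<integral>\<^sup>+(u, s). emeasure (rec_separable_permuton u s) A \<partial>(uniform_sequence \<Otimes>\<^sub>M sign_sequence p))
    = (\<integral>\<^sup>+(x, y, z). indicator A (x, x * y + (1 - x) * z)
        \<partial>(leb_unit \<Otimes>\<^sub>M (beta_distribution p (1 - p) \<Otimes>\<^sub>M beta_distribution (1 - p) p)))"
proof -
  let ?US = "uniform_sequence \<Otimes>\<^sub>M sign_sequence p"
  let ?PQ = "beta_distribution p (1 - p) \<Otimes>\<^sub>M beta_distribution (1 - p) p"
  interpret L: prob_space leb_unit by (rule prob_space_leb_unit)
  interpret U: prob_space uniform_sequence by (rule prob_space_uniform_sequence)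
  interpret S: prob_space "sign_sequence p" by (rule prob_space_sign_sequence)
  interpret P: prob_space "beta_distribution p (1 - p)" using p by (intro prob_space_beta_distribution) auto
  interpret Q: prob_space "beta_distribution (1 - p) p" using p by (intro prob_space_beta_distribution) auto
  interpret US: pair_prob_space uniform_sequence "sign_sequence p" ..
  interpret PQ: pair_prob_space "beta_distribution p (1 - p)" "beta_distribution (1 - p) p" ..
  interpret LUS: pair_sigma_finite leb_unit ?US ..
  have "(\<integral>\<^sup>+(u, s). emeasure (rec_separable_permuton u s) A \<partial>?US)
      = (\<integral>\<^sup>+w. \<integral>\<^sup>+x. indicator A (x, rec_phi (fst w) (snd w) x) \<partial>leb_unit \<partial>?US)"
    by (simp add: emeasure_rec_separable_permuton split_beta')
  also have "\<dots> = (\<integral>\<^sup>+x. \<integral>\<^sup>+w. indicator A (x, rec_phi (fst w) (snd w) x) \<partial>?US \<partial>leb_unit)"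
    by (rule LUS.Fubini') measurable
  also have "\<dots> = (\<integral>\<^sup>+x. \<integral>\<^sup>+w. indicator A (x, x * fst w + (1 - x) * snd w) \<partial>?PQ \<partial>leb_unit)"
  proof (rule nn_integral_cong_AE, rule eventually_mono[OF AE_leb_unit])
    fix x :: real assume x: "0 \<le> x \<and> x \<le> 1"
    have "(\<integral>\<^sup>+w. indicator A (x, rec_phi (fst w) (snd w) x) \<partial>?US)
        = (\<integral>\<^sup>+t. indicator A (x, t) \<partial>distr ?US borel (\<lambda>(u, s). rec_phi u s x))"
      by (subst nn_integral_distr) (auto simp: split_beta')
    also have "\<dots> = (\<integral>\<^sup>+t. indicator A (x, t) \<partial>distr ?PQ borel (\<lambda>(y, z). x * y + (1 - x) * z))"
      using distr_rec_phi[OF p] x by simp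
    also have "\<dots> = (\<integral>\<^sup>+w. indicator A (x, x * fst w + (1 - x) * snd w) \<partial>?PQ)"
      by (subst nn_integral_distr) (auto simp: split_beta')
    finally show "(\<integral>\<^sup>+w. indicator A (x, rec_phi (fst w) (snd w) x) \<partial>?US)
        = (\<integral>\<^sup>+w. indicator A (x, x * fst w + (1 - x) * snd w) \<partial>?PQ)" .
  qed
  also have "\<dots> = (\<integral>\<^sup>+(x, y, z). indicator A (x, x * y + (1 - x) * z) \<partial>(leb_unit \<Otimes>\<^sub>M ?PQ))"
    by (subst PQ.P.nn_integral_fst[symmetric]) (auto simp: split_beta')
  finally show ?thesis .
qed

theorem proposition1p9:
  fixes p :: real
    and M :: "'a measure" and U :: "nat \<Rightarrow> 'a \<Rightarrow> real" and S :: "nat \<Rightarrow> 'a \<Rightarrow> bool"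
    and N :: "'b measure" and V X X' :: "'b \<Rightarrow> real"
  assumes "0 < p" and "p < 1"
    and "prob_space M"
    and "prob_space.indep_vars M (\<lambda>_. borel) U UNIV"
    and "\<And>j. distr M borel (U j) = leb_unit"
    and "prob_space.indep_vars M (\<lambda>_. count_space UNIV) S UNIV"
    and "\<And>j. measure M {\<omega> \<in> space M. S j \<omega>} = p"
    and "prob_space.indep_set M
           {(\<lambda>\<omega> j. U j \<omega>) -` A \<inter> space M | A. A \<in> sets (\<Pi>\<^sub>M j\<in>UNIV. borel)}
           {(\<lambda>\<omega> j. S j \<omega>) -` B \<inter> space M | B. B \<in> sets (\<Pi>\<^sub>M j\<in>UNIV. count_space UNIV)}"
    and "prob_space N"
    and "prob_space.indep_vars N (\<lambda>_. borel) (\<lambda>i. [V, X, X'] ! i) {..<3}"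
    and "distr N borel V = leb_unit"
    and "distr N borel X = beta_distribution p (1 - p)"
    and "distr N borel X' = beta_distribution (1 - p) p"
  shows "intensity_measure M borel (\<lambda>\<omega>. rec_separable_permuton (\<lambda>j. U j \<omega>) (\<lambda>j. S j \<omega>))
           = distr N borel (\<lambda>\<omega>. (V \<omega>, V \<omega> * X \<omega> + (1 - V \<omega>) * X' \<omega>))"
proof -
  interpret M: prob_space M by fact
  interpret N: prob_space N by fact
  note US = distr_uniform_sign_sequence[OF assms(3-8)]
  note VXX = N.distr_triple_indep[OF assms(10)]
  note [measurable] = US(1) VXX(1-3)
  let ?T = "distr N borel (\<lambda>\<omega>. (V \<omega>, V \<omega> * X \<omega> + (1 - V \<omega>) * X' \<omega>))"
  have "(\<integral>\<^sup>+\<omega>. emeasure (rec_separable_permuton (\<lambda>j. U j \<omega>) (\<lambda>j. S j \<omega>)) A \<partial>M) = emeasure ?T A"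
    if A [measurable]: "A \<in> sets borel" for A
  proof -
    have meas: "(\<lambda>(u, s). emeasure (rec_separable_permuton u s) A)
        \<in> borel_measurable (uniform_sequence \<Otimes>\<^sub>M sign_sequence p)"
    proof -
      interpret L: prob_space leb_unit by (rule prob_space_leb_unit)
      show ?thesis by (simp add: emeasure_rec_separable_permuton split_beta')
    qed
    have "(\<integral>\<^sup>+\<omega>. emeasure (rec_separable_permuton (\<lambda>j. U j \<omega>) (\<lambda>j. S j \<omega>)) A \<partial>M)
      = (\<integral>\<^sup>+(u, s). emeasure (rec_separable_permuton u s) A
          \<partial>distr M (uniform_sequence \<Otimes>\<^sub>M sign_sequence p) (\<lambda>\<omega>. (\<lambda>j. U j \<omega>, \<lambda>j. S j \<omega>)))"
      using meas by (subst nn_integral_distr) auto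
    also have "\<dots> = (\<integral>\<^sup>+(x, y, z). indicator A (x, x * y + (1 - x) * z)
        \<partial>distr N (borel \<Otimes>\<^sub>M (borel \<Otimes>\<^sub>M borel)) (\<lambda>\<omega>. (V \<omega>, X \<omega>, X' \<omega>)))"
      unfolding US(2) VXX(4) assms(11-13) by (rule nn_integral_rec_separable_permuton[OF assms(1,2) A])
    also have "\<dots> = (\<integral>\<^sup>+\<omega>. indicator A (V \<omega>, V \<omega> * X \<omega> + (1 - V \<omega>) * X' \<omega>) \<partial>N)"
      by (subst nn_integral_distr) (auto simp: split_beta')
    also have "\<dots> = (\<integral>\<^sup>+z. indicator A z \<partial>?T)"
      by (subst nn_integral_distr) auto
    also have "\<dots> = emeasure ?T A"
      by (subst nn_integral_indicator) auto
    finally show ?thesis .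
  qed
  then have "intensity_measure M borel (\<lambda>\<omega>. rec_separable_permuton (\<lambda>j. U j \<omega>) (\<lambda>j. S j \<omega>))
      = measure_of (space ?T) (sets ?T) (emeasure ?T)"
    unfolding intensity_measure_def using sets.sigma_sets_eq[of "borel :: (real \<times> real) measure"]
    by (auto intro!: measure_of_eq)
  also have "\<dots> = ?T" by (rule measure_of_of_measure)
  finally show ?thesis .
qed

end
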